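(* Let $X$ be an irreducible and aperiodic Markov chain on the finite state space $\mathscr{S}=\{1,\dots,n\}$ with transition matrix $M$ and stationary distribution $\pi$, such that $M_{ij}>0\iff M_{ji}>0$ for all $i,j\in\mathscr{S}$. Let $\mathcal{C}$ be its set of cycles, $w_c$ ($c\in\mathcal{C}$) its cycle weights, $c_-$ the reversed cycle of $c$, and $e_p$ its entropy production rate. Let $Q$ be the probability measure of the maximum entropy RDS of $M$, let $p_c=Q(\alpha:\mathcal{A}(\alpha)=c \mid \mathcal{A}(\alpha)\text{ is single})$ for $c\in\mathcal{C}$, and let $\lambda=1/\sum_{c\in\mathcal{C}}w_c$. Then $$e_p=\sum_{c\in\mathcal{C}}w_c\log\frac{w_c}{w_{c_-}}\qquad\text{and}\qquad e_p=\frac{1}{\lambda}\,H(p_c,p_{c_-}),\quad\text{where } H(p_c,p_{c_-})=\sum_{c\in\mathcal{C}}p_c\log\frac{p_c}{p_{c_-}}.$$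
   Context: Entropy production rate. For initial distribution $p(0)$ with all $p_i(0)>0$, let $$H_t=\sum_{i_0,\dots,i_t\in\mathscr{S}}p_{i_0}(0)M_{i_0i_1}\cdots M_{i_{t-1}i_t}\log\frac{p_{i_0}(0)M_{i_0i_1}\cdots M_{i_{t-1}i_t}}{p_{i_t}(0)M_{i_ti_{t-1}}\cdots M_{i_1i_0}}$$ (relative entropy of the path measure with respect to that of the time-reversed process, with terms of zero probability equal to $0$). Then $e_p=\lim_{t\to\infty}H_t/t=\sum_{i,j}\pi_iM_{ij}\log(M_{ij}/M_{ji})$. Derived chain, cycles, weights. A cycle is an ordered sequence $(i_1,\dots,i_r)$ of distinct states, $r\ge1$, with directed edges $i_1i_2,\dots,i_{r-1}i_r,i_ri_1$, identified up to cyclic rotation (for $r=1$ it is the self-loop $i_1i_1$). Its reverse is $c_-=(i_r,\dots,i_1)$. Along a trajectory $X_0,X_1,\dots$ the derived chain is $\eta_0=[X_0]$; if $\eta_{s-1}=[i_1,\dots,i_k]$ (so $i_k=X_{s-1}$), then: if $X_s\notin\{i_1,\dots,i_k\}$, $\eta_s=[i_1,\dots,i_k,X_s]$; if $X_s=i_r$ for some $r\le k$, then $\eta_s=[i_1,\dots,i_r]$ and the cycle $(i_r,i_{r+1},\dots,i_k)$ is said to be formed at step $s$. Let $w_{c,t}(\omega)$ be the number of times the cycle $c$ is formed up to step $t$. The weight is $w_c=\lim_{t\to\infty}w_{c,t}(\omega)/t$, which exists almost surely and is constant. $\mathcal{C}$ is the set of all cycles that can occur along sample paths, i.e. cycles all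 of whose edges $ij$ satisfy $M_{ij}>0$. Maximum entropy RDS. This is the probability measure $Q$ on the set of all maps $\alpha:\mathscr{S}\to\mathscr{S}$ given by $Q(\alpha)=\prod_{i=1}^nM_{i\,\alpha(i)}$. The attractor of $\alpha$ is single if $\alpha$ has exactly one periodic orbit (exactly one fixed point and no other limit cycle, or exactly one limit cycle and no fixed point); then $\mathcal{A}(\alpha)$ denotes this orbit regarded as a directed cycle. If the attractor is not single, $\mathcal{A}(\alpha)=\emptyset$. *)

theory Defs
  imports "HOL-Probability.Probability"
begin

section \<open>Finite Markov chains\<close>

text \<open>The state space is a finite type \<open>'s\<close>, so it is nonempty and has \<open>CARD('s)\<close> states.\<close>

definition probability_vector :: "real ^ 's::finite \<Rightarrow> bool" where
  "probability_vector p \<longleftrightarrow> (\<forall>i. 0 \<le> p $ i) \<and> (\<Sum>i\<in>UNIV. p $ i) = 1"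

definition stochastic_matrix :: "real ^ 's ^ 's::finite \<Rightarrow> bool" where
  "stochastic_matrix M \<longleftrightarrow> (\<forall>i. probability_vector (M $ i))"

text \<open>The overloaded power on the vector type is componentwise, hence the iterated matrix product.\<close>

definition matrix_pow :: "real ^ 's ^ 's::finite \<Rightarrow> nat \<Rightarrow> real ^ 's ^ 's" where
  "matrix_pow M k = ((\<lambda>A. A ** M) ^^ k) (mat 1)"

definition irreducible_matrix :: "real ^ 's ^ 's::finite \<Rightarrow> bool" where
  "irreducible_matrix M \<longleftrightarrow> (\<forall>i j. \<exists>k. matrix_pow M k $ i $ j > 0)"

definition aperiodic_matrix :: "real ^ 's ^ 's::finite \<Rightarrow> bool" where
  "aperiodic_matrix M \<longleftrightarrow> (\<forall>i. Gcd {k. k \<ge> 1 \<and> matrix_pow M k $ i $ i > 0} = (1::nat))"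

definition stationary_distribution :: "real ^ 's ^ 's::finite \<Rightarrow> real ^ 's \<Rightarrow> bool" where
  "stationary_distribution M \<pi> \<longleftrightarrow> probability_vector \<pi> \<and> \<pi> v* M = \<pi>"

text \<open>The initial law of \<open>X\<close> is arbitrary.\<close>

definition markov_chain :: "'w measure \<Rightarrow> (nat \<Rightarrow> 'w \<Rightarrow> 's::finite) \<Rightarrow> real ^ 's ^ 's \<Rightarrow> bool" where
  "markov_chain P X M \<longleftrightarrow>
     prob_space P \<and> stochastic_matrix M \<and>
     (\<forall>t. X t \<in> measurable P (count_space UNIV)) \<and>
     (\<forall>t i j. \<P>(\<omega> in P. \<forall>s\<le>t. X s \<omega> = i s) > 0 \<longrightarrow>
        \<P>(\<omega> in P. X (Suc t) \<omega> = j \<bar> \<forall>s\<le>t. X s \<omega> = i s) = M $ i t $ j)"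


section \<open>Entropy production rate\<close>

text \<open>\<open>i\<close> runs over the paths \<open>i 0, \<dots>, i t\<close>.  A term of zero probability is \<open>0\<close> because of
  its first factor.\<close>

definition path_relative_entropy :: "real ^ 's ^ 's::finite \<Rightarrow> real ^ 's \<Rightarrow> nat \<Rightarrow> real" where
  "path_relative_entropy M p0 t =
     (\<Sum>i \<in> {..t} \<rightarrow>\<^sub>E UNIV.
        (p0 $ i 0 * (\<Prod>k<t. M $ i k $ i (Suc k))) *
        ln ((p0 $ i 0 * (\<Prod>k<t. M $ i k $ i (Suc k))) /
            (p0 $ i t * (\<Prod>k<t. M $ i (Suc k) $ i k))))"

definition entropy_production_rate :: "real ^ 's ^ 's::finite \<Rightarrow> real ^ 's \<Rightarrow> real" where
  "entropy_production_rate M p0 = lim (\<lambda>t. path_relative_entropy M p0 t / real t)"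


section \<open>Cycles, derived chain and cycle weights\<close>

text \<open>A cycle is represented by the set of all rotations of a nonempty list of distinct states.\<close>

definition cycle_class :: "'s list \<Rightarrow> 's list set" where
  "cycle_class xs = {rotate k xs | k. True}"

definition reverse_cycle :: "'s list set \<Rightarrow> 's list set" where
  "reverse_cycle c = rev ` c"

definition cycles :: "real ^ 's ^ 's::finite \<Rightarrow> 's list set set" where
  "cycles M = {cycle_class xs | xs. xs \<noteq> [] \<and> distinct xs \<and>
     (\<forall>k<length xs. M $ (xs ! k) $ (xs ! (Suc k mod length xs)) > 0)}"

primrec derived_chain :: "(nat \<Rightarrow> 's) \<Rightarrow> nat \<Rightarrow> 's list" where
  "derived_chain x 0 = [x 0]"
| "derived_chain x (Suc s) =
     (if x (Suc s) \<notin> set (derived_chain x s)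
      then derived_chain x s @ [x (Suc s)]
      else takeWhile (\<lambda>y. y \<noteq> x (Suc s)) (derived_chain x s) @ [x (Suc s)])"

text \<open>The cycle formed at step \<open>Suc s\<close> is the part of the derived chain at time \<open>s\<close> that starts
  at the revisited state \<open>x (Suc s)\<close>.\<close>

definition formed_at :: "(nat \<Rightarrow> 's) \<Rightarrow> 's list set \<Rightarrow> nat \<Rightarrow> bool" where
  "formed_at x c s' \<longleftrightarrow> (\<exists>s. s' = Suc s \<and> x (Suc s) \<in> set (derived_chain x s) \<and>
     c = cycle_class (dropWhile (\<lambda>y. y \<noteq> x (Suc s)) (derived_chain x s)))"

definition formation_count :: "(nat \<Rightarrow> 's) \<Rightarrow> 's list set \<Rightarrow> nat \<Rightarrow> nat" where
  "formation_count x c t = card {s \<in> {1..t}. formed_at x c s}"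

definition cycle_weight :: "'w measure \<Rightarrow> (nat \<Rightarrow> 'w \<Rightarrow> 's) \<Rightarrow> 's list set \<Rightarrow> real" where
  "cycle_weight P X c =
     (THE w. AE \<omega> in P. (\<lambda>t. real (formation_count (\<lambda>s. X s \<omega>) c t) / real t) \<longlonglongrightarrow> w)"

lemma finite_cycles: "finite (cycles M)"
proof (rule finite_subset)
  show "cycles M \<subseteq> cycle_class ` {xs. distinct xs}"
    unfolding cycles_def by auto
  have "{xs::'a list. distinct xs} \<subseteq> {xs. set xs \<subseteq> UNIV \<and> length xs \<le> CARD('a)}"
    by (metis (mono_tags, lifting) card_mono distinct_card finite mem_Collect_eq subsetI subset_UNIV)
  moreover have "finite {xs::'a list. set xs \<subseteq> UNIV \<and> length xs \<le> CARD('a)}"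
    by (rule finite_lists_length_le) simp
  ultimately show "finite (cycle_class ` {xs::'a list. distinct xs})"
    using finite_subset by blast
qed


section \<open>Maximum entropy random dynamical system\<close>

definition max_entropy_rds :: "real ^ 's ^ 's::finite \<Rightarrow> ('s \<Rightarrow> 's) pmf" where
  "max_entropy_rds M = embed_pmf (\<lambda>\<alpha>. \<Prod>i\<in>UNIV. M $ i $ \<alpha> i)"

text \<open>The side conditions of \<^const>\<open>embed_pmf\<close> hold for every stochastic matrix:\<close>

lemma pmf_max_entropy_rds:
  fixes M :: "real ^ 's ^ 's::finite"
  assumes "stochastic_matrix M"
  shows "pmf (max_entropy_rds M) \<alpha> = (\<Prod>i\<in>UNIV. M $ i $ \<alpha> i)"
  unfolding max_entropy_rds_def
proof (rule pmf_embed_pmf)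
  have nn: "0 \<le> M $ i $ j" and s1: "(\<Sum>j\<in>UNIV. M $ i $ j) = 1" for i j
    using assms by (auto simp: stochastic_matrix_def probability_vector_def)
  show pos: "0 \<le> (\<Prod>i\<in>UNIV. M $ i $ \<beta> i)" for \<beta>
    by (intro prod_nonneg) (simp add: nn)
  have "(\<Sum>\<beta>\<in>UNIV. \<Prod>i\<in>UNIV. M $ i $ \<beta> i) = (\<Prod>i\<in>UNIV. \<Sum>j\<in>UNIV. M $ i $ j)"
    using prod_sum_PiE[of "UNIV :: 's set" "\<lambda>_. UNIV" "\<lambda>i j. M $ i $ j"]
    by (simp add: PiE_UNIV_domain)
  then have "(\<Sum>\<beta>\<in>UNIV. \<Prod>i\<in>UNIV. M $ i $ \<beta> i) = 1"
    by (simp add: s1)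
  then show "(\<integral>\<^sup>+\<beta>. ennreal (\<Prod>i\<in>UNIV. M $ i $ \<beta> i) \<partial>count_space UNIV) = 1"
    using pos by (simp add: nn_integral_count_space_finite)
qed

definition periodic_orbits :: "('s \<Rightarrow> 's) \<Rightarrow> 's list set set" where
  "periodic_orbits \<alpha> = {cycle_class xs | xs. xs \<noteq> [] \<and> distinct xs \<and>
     (\<forall>k<length xs. \<alpha> (xs ! k) = xs ! (Suc k mod length xs))}"

definition single_attractor :: "('s \<Rightarrow> 's) \<Rightarrow> bool" where
  "single_attractor \<alpha> \<longleftrightarrow> (\<exists>!c. c \<in> periodic_orbits \<alpha>)"

text \<open>The value \<open>{}\<close> is not a cycle, since a \<^const>\<open>cycle_class\<close> is never empty.\<close>

definition attractor :: "('s \<Rightarrow> 's) \<Rightarrow> 's list set" where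
  "attractor \<alpha> = (if single_attractor \<alpha> then (THE c. c \<in> periodic_orbits \<alpha>) else {})"

definition attractor_prob :: "real ^ 's ^ 's::finite \<Rightarrow> 's list set \<Rightarrow> real" where
  "attractor_prob M c =
     \<P>(\<alpha> in measure_pmf (max_entropy_rds M). attractor \<alpha> = c \<bar> single_attractor \<alpha>)"

end

theory Submission
  imports Defs "HOL-Library.Discrete_Functions"
begin

text \<open>
  Draw a random map by choosing \<open>\<alpha> i\<close> independently with law \<open>M i\<close>, and let \<open>F(A)\<close> be the
  probability that every point eventually enters \<open>A\<close>.  Following the orbit of a fixed state \<open>a\<close>
  up to its entry into \<open>A\<close> expands \<open>F(A)\<close> as a sum over simple paths from \<open>a\<close>.  This one
  expansion shows that the derived chain started in \<open>a\<close> has the invariant mass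
  \<open>M(i\<^sub>1,i\<^sub>2) \<cdots> M(i\<^sub>k\<^sub>-\<^sub>1,i\<^sub>k) F({i\<^sub>1,\<dots>,i\<^sub>k})\<close> on \<open>[i\<^sub>1,\<dots>,i\<^sub>k]\<close>, that its total \<open>Z\<close> does not depend
  on \<open>a\<close>, and that the cycle \<open>c\<close> is formed at rate \<open>M(c) F(c) / Z\<close>.  The numerator is exactly
  the probability that \<open>c\<close> is the single attractor of the random map, so \<open>p\<^sub>c\<close> is \<open>w\<^sub>c\<close> normalized;
  and \<open>F(c)\<close> cancels in \<open>w\<^sub>c / w\<^sub>c\<^sub>-\<close>.  The same expansion gives the circulation identity
  \<open>\<Sum>\<^sub>c\<^sub>\<ni>\<^sub>i\<^sub>j M(c) F(c) = F({i}) M(i,j)\<close>, which turns the sum over edges into the sum over cycles.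
  Almost sure convergence of the cycle counts follows from a solution of the Poisson equation for
  the derived chain and the strong law for bounded martingale differences; a solution of the
  Poisson equation for \<open>M\<close> itself yields the entropy production rate.
\<close>

section \<open>The Poisson equation of a finite Markov kernel\<close>

text \<open>The normalized \<open>g\<close> and the constant \<kappa> together have as many
  coordinates as there are equations, so solvability for every \<open>f\<close> follows from
  injectivity, which is a maximum principle. The assumption is one state reachable from everywhere
  because the derived chain need not be irreducible.\<close>

lemma poisson_equation:
  fixes K :: "'x::finite \<Rightarrow> 'x \<Rightarrow> real"
  assumes nonneg: "\<And>x y. 0 \<le> K x y"
    and sum1: "\<And>x. (\<Sum>y\<in>UNIV. K x y) = 1"
    and reach: "\<And>x. (x, x0) \<in> {(x, y). 0 < K x y}\<^sup>*"
  obtains g \<kappa> where "\<And>x. g x + \<kappa> = f x + (\<Sum>y\<in>UNIV. K x y * g y)"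
proof -
  \<comment> \<open>Maximum principle for \<open>f = 0\<close>: at a maximum of \<open>g\<close> the
    average cannot exceed \<open>g\<close>, so \<kappa> \<le> 0; if \<kappa> = 0, the maximum
    spreads along positive transitions down to \<open>x0\<close>.\<close>
  have upper: "\<kappa> \<le> 0 \<and> (\<kappa> = 0 \<longrightarrow> (\<forall>x. g x \<le> g x0))"
    if eq: "\<And>x. g x + \<kappa> = (\<Sum>y\<in>UNIV. K x y * g y)" for g and \<kappa> :: real
  proof -
    define b where "b = Max (range g)"
    have le: "g y \<le> b" for y
      by (simp add: b_def)
    have "b \<in> range g"
      unfolding b_def by (rule Max_in) auto
    then obtain z where z: "g z = b"
      by auto
    have defect: "(\<Sum>y\<in>UNIV. K x y * (b - g y)) = b - (g x + \<kappa>)" for x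
      by (simp add: eq right_diff_distrib sum_subtractf flip: sum_distrib_right) (simp add: sum1)
    have "0 \<le> (\<Sum>y\<in>UNIV. K z y * (b - g y))"
      by (intro sum_nonneg mult_nonneg_nonneg) (auto simp: nonneg le)
    with defect[of z] z have "\<kappa> \<le> 0"
      by simp
    moreover have "g x \<le> g x0" if "\<kappa> = 0" for x
    proof -
      have step: "g y = b" if "g x = b" "0 < K x y" for x y
      proof -
        have "(\<Sum>y\<in>UNIV. K x y * (b - g y)) = 0"
          using defect[of x] \<open>\<kappa> = 0\<close> that by simp
        then have "K x y * (b - g y) = 0"
          by (subst (asm) sum_nonneg_eq_0_iff) (auto simp: nonneg le)
        with that show ?thesis
          by simp
      qed
      have "g x0 = b"
        using reach[of z] by (induction rule: rtrancl_induct) (use z step in auto)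
      then show ?thesis
        using le by simp
    qed
    ultimately show ?thesis
      by blast
  qed
  \<comment> \<open>Normalize \<open>g x0 = 0\<close>, so that the coordinate \<open>x0\<close> of the unknown is free to carry \<open>\<kappa>\<close>.\<close>
  define E where "E u y = (if y = x0 then 0 else u $ y)" for u :: "real ^ 'x" and y
  define \<Phi> where "\<Phi> u = (\<chi> x. E u x - (\<Sum>y\<in>UNIV. K x y * E u y) + u $ x0)" for u :: "real ^ 'x"
  have E_add: "E (u + v) y = E u y + E v y" and E_scale: "E (r *\<^sub>R u) y = r * E u y" for u v y r
    by (simp_all add: E_def)
  have lin: "linear \<Phi>"
    by (rule linearI)
      (simp_all add: \<Phi>_def vec_eq_iff E_add E_scale sum.distrib algebra_simps sum_distrib_left)
  have "u = 0" if "\<Phi> u = 0" for u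
  proof -
    have eq: "E u x + u $ x0 = (\<Sum>y\<in>UNIV. K x y * E u y)" for x
      using that by (simp add: \<Phi>_def vec_eq_iff algebra_simps)
    \<comment> \<open>The negated solution satisfies the same equation, so the two one-sided bounds
      force the constant to vanish and \<open>E u\<close> to be constant.\<close>
    have eq': "- E u x + - u $ x0 = (\<Sum>y\<in>UNIV. K x y * - E u y)" for x
      using eq[of x] by (simp add: sum_negf)
    have *: "u $ x0 \<le> 0 \<and> (u $ x0 = 0 \<longrightarrow> (\<forall>x. E u x \<le> E u x0))"
      by (rule upper) (rule eq)
    have **: "- u $ x0 \<le> 0 \<and> (- u $ x0 = 0 \<longrightarrow> (\<forall>x. - E u x \<le> - E u x0))"
      by (rule upper) (rule eq')
    have z: "u $ x0 = 0"
      using * ** by simp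
    with * ** have "E u x = E u x0" for x
      by (simp add: antisym)
    then have "E u x = 0" for x
      by (simp add: E_def)
    then have "u $ x = 0" for x
      using z by (metis E_def)
    then show ?thesis
      by (simp add: vec_eq_iff)
  qed
  then have "inj \<Phi>"
    using lin by (simp add: linear_injective_0)
  then have "surj \<Phi>"
    by (rule linear_injective_imp_surjective[OF lin _ refl])
  then obtain u where u: "\<Phi> u = (\<chi> x. f x)"
    by (metis surjD)
  show ?thesis
  proof (rule that[of "E u" "u $ x0"])
    show "E u x + u $ x0 = f x + (\<Sum>y\<in>UNIV. K x y * E u y)" for x
      using u by (simp add: \<Phi>_def vec_eq_iff algebra_simps)
  qed
qed

section \<open>Orbits of maps and simple paths\<close>

text \<open>An inductive predicate in place of iterates of \<alpha>: rule induction runs backwards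
  along the orbit from its entry into \<open>A\<close>.\<close>

inductive hits :: "('s \<Rightarrow> 's) \<Rightarrow> 's set \<Rightarrow> 's \<Rightarrow> bool" for \<alpha> A where
  base: "x \<in> A \<Longrightarrow> hits \<alpha> A x"
| step: "hits \<alpha> A (\<alpha> x) \<Longrightarrow> hits \<alpha> A x"

text \<open>Outside \<open>A\<close> such a map is a spanning forest whose edges point towards roots
  in \<open>A\<close>.\<close>

definition flows :: "('s \<Rightarrow> 's) \<Rightarrow> 's set \<Rightarrow> bool" where
  "flows \<alpha> A \<longleftrightarrow> (\<forall>x. hits \<alpha> A x)"

abbreviation follows :: "('s \<Rightarrow> 's) \<Rightarrow> 's list \<Rightarrow> bool" where
  "follows \<alpha> \<equiv> successively (\<lambda>x y. \<alpha> x = y)"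

text \<open>The possible orbit segments up to the first entry into \<open>A\<close>; a start inside
  \<open>A\<close> leaves only the one-element list.\<close>

definition simple_paths_to :: "'s set \<Rightarrow> 's list set" where
  "simple_paths_to A = {ys. ys \<noteq> [] \<and> distinct ys \<and> last ys \<in> A \<and> set (butlast ys) \<inter> A = {}}"

lemma hits_mono: "hits \<alpha> A x \<Longrightarrow> A \<subseteq> B \<Longrightarrow> hits \<alpha> B x"
  by (induction rule: hits.induct) (auto intro: hits.intros)

lemma hits_trans: "hits \<alpha> B x \<Longrightarrow> (\<And>y. y \<in> B \<Longrightarrow> hits \<alpha> A y) \<Longrightarrow> hits \<alpha> A x"
  by (induction rule: hits.induct) (auto intro: hits.intros)

lemma hits_cong: "hits \<alpha> A x \<Longrightarrow> (\<And>y. y \<notin> A \<Longrightarrow> \<alpha> y = \<beta> y) \<Longrightarrow> hits \<beta> A x"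
proof (induction rule: hits.induct)
  case (step x)
  then show ?case
    by (cases "x \<in> A") (auto intro: hits.intros)
qed (rule hits.base)

text \<open>An orbit is followed only up to its entry into \<open>A\<close>. For random maps this
  makes the event independent of the values chosen on \<open>A\<close>.\<close>

lemma flows_cong: "(\<And>y. y \<notin> A \<Longrightarrow> \<alpha> y = \<beta> y) \<Longrightarrow> flows \<alpha> A \<longleftrightarrow> flows \<beta> A"
  unfolding flows_def using hits_cong by metis

lemma flows_mono: "flows \<alpha> A \<Longrightarrow> A \<subseteq> B \<Longrightarrow> flows \<alpha> B"
  unfolding flows_def using hits_mono by metis

lemma hits_closed: "hits \<alpha> A x \<Longrightarrow> x \<in> C \<Longrightarrow> (\<And>y. y \<in> C \<Longrightarrow> \<alpha> y \<in> C) \<Longrightarrow> A \<inter> C \<noteq> {}"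
  by (induction rule: hits.induct) auto

lemma follows_hits: "follows \<alpha> ys \<Longrightarrow> y \<in> set ys \<Longrightarrow> last ys \<in> A \<Longrightarrow> hits \<alpha> A y"
proof (induction ys arbitrary: y)
  case (Cons z ys)
  then show ?case
    by (cases "ys = []") (auto intro: hits.intros simp: successively_Cons)
qed simp

lemma hits_imp_path:
  assumes "hits \<alpha> A x"
  obtains ys where "ys \<in> simple_paths_to A" "hd ys = x" "follows \<alpha> ys"
proof -
  have "\<exists>ys. ys \<in> simple_paths_to A \<and> hd ys = x \<and> follows \<alpha> ys"
    using assms
  proof (induction rule: hits.induct)
    case (base x)
    then show ?case
      by (intro exI[of _ "[x]"]) (simp add: simple_paths_to_def)
  next
    case (step x)
    then obtain ys where ys: "ys \<in> simple_paths_to A" "hd ys = \<alpha> x" "follows \<alpha> ys"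
      by auto
    show ?case
    proof (cases "x \<in> set ys")
      case True
      \<comment> \<open>If the path from \<open>\<alpha> x\<close> comes back to \<open>x\<close>,
        its suffix from \<open>x\<close> onwards is already the path wanted.\<close>
      then obtain us vs where "ys = us @ x # vs"
        by (auto simp: in_set_conv_decomp)
      then show ?thesis
        using ys by (intro exI[of _ "x # vs"])
          (auto simp: simple_paths_to_def butlast_append successively_append_iff split: if_splits)
    next
      case False
      show ?thesis
      proof (cases "x \<in> A")
        case True
        then show ?thesis
          by (intro exI[of _ "[x]"]) (simp add: simple_paths_to_def)
      next
        case False
        then show ?thesis
          using ys \<open>x \<notin> set ys\<close> by (intro exI[of _ "x # ys"])
            (auto simp: simple_paths_to_def successively_Cons)
      qed
    qed
  qed
  then show ?thesis
    using that by blast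
qed

text \<open>The map determines the successor of each state and membership in \<open>A\<close>
  decides where to stop, so the start fixes the path. This makes the events in the path expansion
  disjoint.\<close>

lemma follows_path_unique:
  "follows \<alpha> ys \<Longrightarrow> follows \<alpha> zs \<Longrightarrow> ys \<in> simple_paths_to A \<Longrightarrow> zs \<in> simple_paths_to A \<Longrightarrow>
    hd ys = hd zs \<Longrightarrow> ys = zs"
proof (induction ys arbitrary: zs)
  case Nil
  then show ?case by (simp add: simple_paths_to_def)
next
  case (Cons y ys)
  obtain z zs' where zs: "zs = z # zs'"
    using Cons.prems by (cases zs) (auto simp: simple_paths_to_def)
  show ?case
  proof (cases "y \<in> A")
    case True
    then show ?thesis
      using Cons.prems zs by (auto simp: simple_paths_to_def split: if_splits)
  next
    case False
    then have ne: "ys \<noteq> []" "zs' \<noteq> []"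
      using Cons.prems zs by (auto simp: simple_paths_to_def split: if_splits)
    have "ys = zs'"
      using Cons.prems ne zs
      by (intro Cons.IH) (auto simp: simple_paths_to_def successively_Cons)
    then show ?thesis
      using Cons.prems zs by simp
  qed
qed

text \<open>Stopping at \<open>i\<close> as well and then discarding the paths that end there
  expresses that the rest of the path avoids \<open>i\<close>.\<close>

lemma simple_paths_to_Cons:
  "i \<notin> A \<Longrightarrow> i # ys \<in> simple_paths_to A \<longleftrightarrow> ys \<in> simple_paths_to (insert i A) \<and> last ys \<noteq> i"
  by (cases "ys = []")
    (auto simp: simple_paths_to_def dest: in_set_butlastD, metis append_butlast_last_id rotate1.simps(2) set_ConsD set_rotate1)

lemma finite_distinct_lists: "finite {xs :: 's::finite list. distinct xs}"
  by (rule finite_subset[OF _ finite_lists_length_le[of UNIV "CARD('s)"]])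
    (auto simp: card_mono simp flip: distinct_card)

lemma finite_simple_paths_to: "finite (simple_paths_to (A :: 's::finite set))"
  by (rule finite_subset[OF _ finite_distinct_lists]) (auto simp: simple_paths_to_def)

section \<open>Random maps\<close>

lemma follows_update: "x \<notin> set (butlast ys) \<Longrightarrow> follows (\<alpha>(x := j)) ys \<longleftrightarrow> follows \<alpha> ys"
  by (induction ys rule: induct_list012) auto

locale stochastic_kernel =
  fixes m :: "'s::finite \<Rightarrow> 's \<Rightarrow> real"
  assumes nonneg: "0 \<le> m i j"
    and row_sum: "(\<Sum>j\<in>UNIV. m i j) = 1"
begin

definition map_weight :: "('s \<Rightarrow> 's) \<Rightarrow> real" where
  "map_weight \<alpha> = (\<Prod>i\<in>UNIV. m i (\<alpha> i))"

definition map_prob :: "('s \<Rightarrow> 's) set \<Rightarrow> real" where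
  "map_prob E = (\<Sum>\<alpha>\<in>E. map_weight \<alpha>)"

text \<open>The total weight of the spanning forests rooted in \<open>A\<close>, since the choices
  on \<open>A\<close> sum to 1; for a singleton these are the tree weights of the Markov chain tree
  theorem.\<close>

definition forest :: "'s set \<Rightarrow> real" where
  "forest A = map_prob {\<alpha>. flows \<alpha> A}"

fun path_weight :: "'s list \<Rightarrow> real" where
  "path_weight (x # y # zs) = m x y * path_weight (y # zs)"
| "path_weight _ = 1"

lemma map_weight_nonneg: "0 \<le> map_weight \<alpha>"
  unfolding map_weight_def by (intro prod_nonneg) (simp add: nonneg)

lemma map_prob_nonneg: "0 \<le> map_prob E"
  unfolding map_prob_def by (intro sum_nonneg map_weight_nonneg)

lemma forest_nonneg: "0 \<le> forest A"
  unfolding forest_def by (rule map_prob_nonneg)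

lemma path_weight_append:
  "xs \<noteq> [] \<Longrightarrow> ys \<noteq> [] \<Longrightarrow>
    path_weight (xs @ ys) = path_weight xs * m (last xs) (hd ys) * path_weight ys"
proof (induction xs rule: path_weight.induct)
  case ("2_2" v)
  then show ?case
    by (cases ys) auto
qed auto

lemma path_weight_split:
  "path_weight (us @ x # vs) = path_weight (us @ [x]) * path_weight (x # vs)"
  by (cases "us = []") (auto simp: path_weight_append)

text \<open>The value at \<open>x\<close> is independent of an event that does not look at it:
  reassigning it is a weight-scaling bijection between the slices for two values. The identity
  \<open>swap\<close> is cross-multiplied, as matrix entries may vanish.\<close>

lemma map_prob_coordinate:
  assumes "\<And>\<alpha> j. \<alpha>(x := j) \<in> E \<longleftrightarrow> \<alpha> \<in> E"
  shows "map_prob {\<alpha> \<in> E. \<alpha> x = j} = m x j * map_prob E"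
proof -
  have swap: "m x j' * map_prob {\<alpha> \<in> E. \<alpha> x = j} = m x j * map_prob {\<alpha> \<in> E. \<alpha> x = j'}" for j'
    unfolding map_prob_def sum_distrib_left
  proof (rule sum.reindex_bij_witness[where i = "\<lambda>\<alpha>. \<alpha>(x := j)" and j = "\<lambda>\<alpha>. \<alpha>(x := j')"])
    fix \<alpha> assume "\<alpha> \<in> {\<alpha> \<in> E. \<alpha> x = j}"
    moreover have "map_weight \<beta> = m x (\<beta> x) * (\<Prod>i\<in>UNIV - {x}. m i (\<beta> i))" for \<beta>
      unfolding map_weight_def by (rule prod.remove) auto
    ultimately show "m x j * map_weight (\<alpha>(x := j')) = m x j' * map_weight \<alpha>"
      by simp
  qed (use assms in \<open>auto simp: fun_eq_iff\<close>)
  have "map_prob E = (\<Sum>j'\<in>UNIV. map_prob {\<alpha> \<in> E. \<alpha> x = j'})"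
    unfolding map_prob_def
    by (rule sum.group[symmetric]) auto
  then have "m x j * map_prob E = (\<Sum>j'\<in>UNIV. m x j' * map_prob {\<alpha> \<in> E. \<alpha> x = j})"
    by (simp add: sum_distrib_left swap)
  also have "\<dots> = map_prob {\<alpha> \<in> E. \<alpha> x = j}"
    by (simp add: row_sum flip: sum_distrib_right)
  finally show ?thesis ..
qed

text \<open>Each edge of \<open>xs\<close> fixes the value at one new state. The last state carries
  no condition, so it may repeat the first one, as closed paths require.\<close>

lemma map_prob_follows:
  assumes "distinct (butlast xs)"
    and "\<And>\<alpha> x j. x \<in> set (butlast xs) \<Longrightarrow> \<alpha>(x := j) \<in> E \<longleftrightarrow> \<alpha> \<in> E"
  shows "map_prob {\<alpha> \<in> E. follows \<alpha> xs} = path_weight xs * map_prob E"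
  using assms
proof (induction xs rule: path_weight.induct)
  case (1 x y zs)
  let ?E = "{\<alpha> \<in> E. follows \<alpha> (y # zs)}"
  have "map_prob {\<alpha> \<in> ?E. \<alpha> x = y} = m x y * map_prob ?E"
  proof (rule map_prob_coordinate)
    show "\<alpha>(x := j) \<in> ?E \<longleftrightarrow> \<alpha> \<in> ?E" for \<alpha> j
    proof -
      have "x \<notin> set (butlast (y # zs))"
        using 1(2) by simp
      then have "follows (\<alpha>(x := j)) (y # zs) \<longleftrightarrow> follows \<alpha> (y # zs)"
        by (rule follows_update)
      moreover have "\<alpha>(x := j) \<in> E \<longleftrightarrow> \<alpha> \<in> E"
        by (rule 1(3)) simp
      ultimately show ?thesis
        by blast
    qed
  qed
  moreover have "map_prob ?E = path_weight (y # zs) * map_prob E"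
    using 1(2,3) by (intro 1(1)) auto
  moreover have "{\<alpha> \<in> ?E. \<alpha> x = y} = {\<alpha> \<in> E. follows \<alpha> (x # y # zs)}"
    by auto
  ultimately show ?case
    by simp
qed auto

lemma forest_follows:
  assumes "distinct (butlast xs)" "set (butlast xs) \<subseteq> A"
  shows "map_prob {\<alpha>. flows \<alpha> A \<and> follows \<alpha> xs} = path_weight xs * forest A"
proof -
  have "map_prob {\<alpha> \<in> {\<alpha>. flows \<alpha> A}. follows \<alpha> xs} = path_weight xs * map_prob {\<alpha>. flows \<alpha> A}"
    using assms by (intro map_prob_follows) (auto intro!: flows_cong)
  then show ?thesis
    by (simp add: forest_def)
qed

text \<open>The event is split according to the orbit segment \<open>ys\<close> of \<open>a\<close>
  up to \<open>A\<close>: given that segment, reaching \<open>A\<close> amounts to reaching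
  \<open>A \<union> set ys\<close>, and this is independent of the values fixed along
  \<open>ys\<close>. The freedom to choose \<open>a\<close> is what the later identities
  exploit.\<close>

lemma forest_eq_sum_paths:
  "forest A = (\<Sum>ys | ys \<in> simple_paths_to A \<and> hd ys = a. path_weight ys * forest (A \<union> set ys))"
proof -
  let ?S = "{ys. ys \<in> simple_paths_to A \<and> hd ys = a}"
  let ?E = "\<lambda>ys. {\<alpha>. flows \<alpha> (A \<union> set ys) \<and> follows \<alpha> ys}"
  have "{\<alpha>. flows \<alpha> A} = (\<Union>ys\<in>?S. ?E ys)"
  proof (intro equalityI subsetI)
    fix \<alpha> assume "\<alpha> \<in> {\<alpha>. flows \<alpha> A}"
    then have fl: "flows \<alpha> A"
      by simp
    then have "hits \<alpha> A a"
      by (simp add: flows_def)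
    then obtain ys where "ys \<in> simple_paths_to A" "hd ys = a" "follows \<alpha> ys"
      by (rule hits_imp_path)
    with fl show "\<alpha> \<in> (\<Union>ys\<in>?S. ?E ys)"
      by (auto intro: flows_mono)
  next
    fix \<alpha> assume "\<alpha> \<in> (\<Union>ys\<in>?S. ?E ys)"
    then obtain ys where ys: "ys \<in> ?S" "flows \<alpha> (A \<union> set ys)" "follows \<alpha> ys"
      by auto
    have "hits \<alpha> A y" if "y \<in> A \<union> set ys" for y
      using that ys follows_hits[of \<alpha> ys y A] by (auto simp: simple_paths_to_def intro: hits.base)
    then show "\<alpha> \<in> {\<alpha>. flows \<alpha> A}"
      using ys(2) by (auto simp: flows_def intro: hits_trans)
  qed
  then have "forest A = map_prob (\<Union>ys\<in>?S. ?E ys)"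
    by (simp add: forest_def)
  also have "\<dots> = (\<Sum>ys\<in>?S. map_prob (?E ys))"
    unfolding map_prob_def
  proof (rule sum.UNION_disjoint)
    show "finite ?S"
      using finite_simple_paths_to by (rule rev_finite_subset) auto
    show "\<forall>ys\<in>?S. \<forall>zs\<in>?S. ys \<noteq> zs \<longrightarrow> ?E ys \<inter> ?E zs = {}"
      using follows_path_unique by fastforce
  qed auto
  also have "\<dots> = (\<Sum>ys\<in>?S. path_weight ys * forest (A \<union> set ys))"
    by (intro sum.cong refl forest_follows)
      (auto simp: simple_paths_to_def distinct_butlast dest: in_set_butlastD)
  finally show ?thesis .
qed

text \<open>The path expansion is averaged over the first step \<open>j\<close> from
  \<open>i\<close>. Paths ending in \<open>A\<close>, prefixed by \<open>i\<close>, make up the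
  expansion of \<open>forest A\<close> from \<open>i\<close>; those ending at \<open>i\<close> close
  a cycle through \<open>i\<close> outside \<open>A\<close>.\<close>

lemma forest_insert:
  assumes "i \<notin> A"
  shows "forest (insert i A) = forest A +
    (\<Sum>vs | distinct (i # vs) \<and> set (i # vs) \<inter> A = {}.
      path_weight (i # vs @ [i]) * forest (A \<union> set (i # vs)))"
proof -
  let ?B = "insert i A"
  let ?f = "\<lambda>ys. path_weight (i # ys) * forest (?B \<union> set ys)"
  note fin = finite_simple_paths_to[of ?B]
  have pw: "path_weight (i # ys) = m i (hd ys) * path_weight ys" if "ys \<noteq> []" for ys
    using that by (cases ys) auto
  have "forest ?B = (\<Sum>j\<in>UNIV. m i j * forest ?B)"
    by (simp add: row_sum flip: sum_distrib_right)
  also have "\<dots> = (\<Sum>j\<in>UNIV. \<Sum>ys | ys \<in> simple_paths_to ?B \<and> hd ys = j. ?f ys)"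
  proof (rule sum.cong[OF refl])
    fix j
    show "m i j * forest ?B = (\<Sum>ys | ys \<in> simple_paths_to ?B \<and> hd ys = j. ?f ys)"
      unfolding forest_eq_sum_paths[of ?B j] sum_distrib_left
    proof (rule sum.cong[OF refl])
      fix ys assume "ys \<in> {ys. ys \<in> simple_paths_to ?B \<and> hd ys = j}"
      then have "ys \<noteq> []" "hd ys = j"
        by (auto simp: simple_paths_to_def)
      then show "m i j * (path_weight ys * forest (?B \<union> set ys)) = ?f ys"
        using pw[of ys] by simp
    qed
  qed
  also have "\<dots> = (\<Sum>ys\<in>simple_paths_to ?B. ?f ys)"
    by (rule sum.group[OF fin]) auto
  also have "\<dots> = (\<Sum>ys | ys \<in> simple_paths_to ?B \<and> last ys \<noteq> i. ?f ys) +
      (\<Sum>ys | ys \<in> simple_paths_to ?B \<and> last ys = i. ?f ys)"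
    by (subst sum.union_disjoint[symmetric]) (auto intro!: sum.cong intro: rev_finite_subset[OF fin])
  also have "(\<Sum>ys | ys \<in> simple_paths_to ?B \<and> last ys \<noteq> i. ?f ys) = forest A"
  proof -
    have "{zs. zs \<in> simple_paths_to A \<and> hd zs = i} =
        (#) i ` {ys. ys \<in> simple_paths_to ?B \<and> last ys \<noteq> i}" (is "?L = (#) i ` ?R")
    proof (intro equalityI subsetI)
      fix zs assume zs: "zs \<in> ?L"
      then obtain ys where "zs = i # ys"
        by (cases zs) (auto simp: simple_paths_to_def)
      with zs show "zs \<in> (#) i ` ?R"
        using assms by (simp add: simple_paths_to_Cons)
    qed (use assms in \<open>auto simp: simple_paths_to_Cons\<close>)
    then show ?thesis
      unfolding forest_eq_sum_paths[of A i] by (simp add: sum.reindex)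
  qed
  also have "(\<Sum>ys | ys \<in> simple_paths_to ?B \<and> last ys = i. ?f ys) =
      (\<Sum>vs | distinct (i # vs) \<and> set (i # vs) \<inter> A = {}.
        path_weight (i # vs @ [i]) * forest (A \<union> set (i # vs)))"
  proof -
    have "{ys. ys \<in> simple_paths_to ?B \<and> last ys = i} =
        (\<lambda>vs. vs @ [i]) ` {vs. distinct (i # vs) \<and> set (i # vs) \<inter> A = {}}" (is "?L = ?h ` ?R")
    proof (intro equalityI subsetI)
      fix ys assume ys: "ys \<in> ?L"
      then have "ys = butlast ys @ [i]"
        by (auto simp: simple_paths_to_def)
      moreover from this ys have "butlast ys \<in> ?R"
        using assms by (auto simp: simple_paths_to_def distinct_butlast)
      ultimately show "ys \<in> ?h ` ?R"
        by (rule image_eqI)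
    qed (use assms in \<open>auto simp: simple_paths_to_def\<close>)
    moreover have "inj_on ?h ?R"
      by (auto simp: inj_on_def)
    ultimately show ?thesis
      by (simp add: sum.reindex)
  qed
  finally show ?thesis .
qed

end

section \<open>Cycles as rotation classes\<close>

definition simple_lists :: "'s list set" where
  "simple_lists = {xs. xs \<noteq> [] \<and> distinct xs}"

lemma finite_simple_lists: "finite (simple_lists :: 's::finite list set)"
  by (rule finite_subset[OF _ finite_distinct_lists]) (auto simp: simple_lists_def)

text \<open>A rotation \<open>ys\<close> stands for the edge from \<open>last ys\<close> to
  \<open>hd ys\<close>. With the shift \<open>Suc k\<close>, index \<open>k\<close> belongs to the
  edge that leaves \<open>xs ! k\<close>; products and conditions over edges thus become ones over
  the class itself.\<close>

lemma bij_betw_rotate_cycle_class: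
  assumes "xs \<in> simple_lists"
  shows "bij_betw (\<lambda>k. rotate (Suc k) xs) {..<length xs} (cycle_class xs)"
proof -
  let ?n = "length xs"
  have n: "xs \<noteq> []" "distinct xs" "0 < ?n"
    using assms by (auto simp: simple_lists_def)
  have "inj_on (\<lambda>k. rotate (Suc k) xs) {..<?n}"
  proof (rule inj_onI)
    fix k l assume kl: "k \<in> {..<?n}" "l \<in> {..<?n}" and eq: "rotate (Suc k) xs = rotate (Suc l) xs"
    have "rotate1 (rotate k xs) = rotate1 (rotate l xs)"
      using eq by simp
    then have "last (rotate1 (rotate k xs)) = last (rotate1 (rotate l xs))"
      by simp
    then have "hd (rotate k xs) = hd (rotate l xs)"
      using n(1) by (metis hd_rotate_conv_nth last_snoc list.exhaust_sel rotate1.simps(2) rotate_is_Nil_conv)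
    then have "xs ! k = xs ! l"
      using kl n by (simp add: hd_rotate_conv_nth)
    then show "k = l"
      using kl n by (simp add: nth_eq_iff_index_eq)
  qed
  moreover have "cycle_class xs = (\<lambda>k. rotate (Suc k) xs) ` {..<?n}"
  proof (intro equalityI subsetI)
    fix ys assume "ys \<in> cycle_class xs"
    then obtain k where k: "ys = rotate k xs"
      by (auto simp: cycle_class_def)
    \<comment> \<open>This is \<open>k - 1\<close> modulo the length; adding \<open>?n - 1\<close>
      avoids truncated subtraction at \<open>k = 0\<close>.\<close>
    define l where "l = (k + (?n - 1)) mod ?n"
    have "Suc l mod ?n = Suc (k + (?n - 1)) mod ?n"
      unfolding l_def by (rule mod_Suc_eq)
    also have "Suc (k + (?n - 1)) = k + ?n"
      using n by simp
    finally have "rotate (Suc l) xs = ys"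
      unfolding k by (metis mod_add_self2 rotate_conv_mod)
    then show "ys \<in> (\<lambda>k. rotate (Suc k) xs) ` {..<?n}"
      using n by (intro image_eqI[of _ _ l]) (simp_all only:, simp add: l_def)
  qed (auto simp: cycle_class_def simp del: rotate_Suc)
  ultimately show ?thesis
    by (simp add: bij_betw_def)
qed

lemma hd_rotate_Suc:
  "k < length xs \<Longrightarrow> hd (rotate (Suc k) xs) = xs ! (Suc k mod length xs)"
  by (rule hd_rotate_conv_nth) auto

lemma last_rotate1: "xs \<noteq> [] \<Longrightarrow> last (rotate1 xs) = hd xs"
  by (cases xs) auto

lemma last_rotate_Suc:
  assumes "k < length xs"
  shows "last (rotate (Suc k) xs) = xs ! k"
proof -
  have "xs \<noteq> []"
    using assms by auto
  then show ?thesis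
    using assms by (simp add: last_rotate1 hd_rotate_conv_nth)
qed

lemma nth_closed_path:
  assumes "k < length xs"
  shows "(xs @ [hd xs]) ! Suc k = xs ! (Suc k mod length xs)"
proof -
  have "xs \<noteq> []"
    using assms by auto
  then show ?thesis
    using assms by (cases "Suc k = length xs") (auto simp: nth_append hd_conv_nth)
qed

lemma all_cycle_edges_iff:
  assumes "xs \<in> simple_lists"
  shows "(\<forall>k<length xs. R (xs ! k) (xs ! (Suc k mod length xs))) \<longleftrightarrow>
    (\<forall>ys\<in>cycle_class xs. R (last ys) (hd ys))"
proof -
  have "cycle_class xs = (\<lambda>k. rotate (Suc k) xs) ` {..<length xs}"
    using bij_betw_rotate_cycle_class[OF assms] by (simp add: bij_betw_def)
  then show ?thesis
    by (auto simp: hd_rotate_Suc last_rotate_Suc simp del: rotate_Suc)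
qed

lemma successively_closed_path:
  assumes "xs \<in> simple_lists"
  shows "successively R (xs @ [hd xs]) \<longleftrightarrow> (\<forall>ys\<in>cycle_class xs. R (last ys) (hd ys))"
proof -
  have "(xs @ [hd xs]) ! k = xs ! k" if "k < length xs" for k
    using that by (simp add: nth_append)
  then show ?thesis
    unfolding all_cycle_edges_iff[OF assms, symmetric] successively_conv_nth
    using nth_closed_path[of _ xs] by simp
qed

lemma self_in_cycle_class: "xs \<in> cycle_class xs"
  unfolding cycle_class_def by (auto intro: exI[of _ 0])

lemma cycle_class_eq:
  assumes "ys \<in> cycle_class xs"
  shows "cycle_class ys = cycle_class xs"
proof -
  obtain k where k: "ys = rotate k xs"
    using assms by (auto simp: cycle_class_def)
  have "rotate l xs \<in> cycle_class ys" for l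
  proof -
    \<comment> \<open>The amount \<open>length xs - k mod length xs\<close> completes the turn begun
      by \<open>k\<close>.\<close>
    have "rotate (l + (length xs - k mod length xs)) ys = rotate (l + length xs) xs" if "xs \<noteq> []"
    proof -
      have "rotate (l + (length xs - k mod length xs)) ys =
          rotate (l + (length xs - k mod length xs)) (rotate (k mod length xs) xs)"
        unfolding k by (metis rotate_conv_mod)
      also have "\<dots> = rotate (l + length xs) xs"
      proof -
        have "k mod length xs < length xs"
          using that by simp
        then have "l + (length xs - k mod length xs) + k mod length xs = l + length xs"
          by linarith
        then show ?thesis
          by (simp only: rotate_rotate)
      qed
      finally show ?thesis .
    qed
    then have "rotate (l + (length xs - k mod length xs)) ys = rotate l xs"
      unfolding k by (cases "xs = []") (simp, metis mod_add_self2 rotate_conv_mod)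
    then show ?thesis
      unfolding cycle_class_def by (metis (mono_tags, lifting) mem_Collect_eq)
  qed
  then show ?thesis
    using k by (auto simp: cycle_class_def rotate_rotate)
qed

lemma mem_cycle_class:
  assumes "ys \<in> cycle_class xs"
  shows "set ys = set xs" "length ys = length xs" "distinct ys \<longleftrightarrow> distinct xs"
    "ys \<in> simple_lists \<longleftrightarrow> xs \<in> simple_lists"
  using assms by (auto simp: cycle_class_def simple_lists_def)

lemma cycle_class_eq_iff: "cycle_class xs = cycle_class ys \<longleftrightarrow> xs \<in> cycle_class ys"
  using cycle_class_eq self_in_cycle_class by blast

lemma cycle_class_rotate1: "cycle_class (rotate1 xs) = cycle_class xs"
  unfolding cycle_class_eq_iff by (auto simp: cycle_class_def intro: exI[of _ "Suc 0"])

lemma Union_cycle_class: "\<Union> (set ` cycle_class xs) = set xs"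
proof -
  have "\<Union> (set ` cycle_class xs) = (\<Union>ys\<in>cycle_class xs. set xs)"
    by (rule SUP_cong) (auto simp: mem_cycle_class)
  then show ?thesis
    using self_in_cycle_class[of xs] by auto
qed

lemma cycle_class_ex_hd:
  assumes "j \<in> set xs"
  shows "\<exists>ys\<in>cycle_class xs. hd ys = j"
proof -
  obtain k where "k < length xs" "xs ! k = j"
    using assms by (auto simp: in_set_conv_nth)
  moreover have "hd (rotate k xs) = xs ! (k mod length xs)"
    using assms by (intro hd_rotate_conv_nth) auto
  ultimately show ?thesis
    by (auto simp: cycle_class_def)
qed

lemma cycle_class_hd_inj:
  assumes "xs \<in> simple_lists" "ys \<in> cycle_class xs" "zs \<in> cycle_class xs" "hd ys = hd zs"
  shows "ys = zs"
proof -
  have ne: "xs \<noteq> []" "distinct xs"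
    using assms by (auto simp: simple_lists_def)
  obtain k l where k: "ys = rotate k xs" and l: "zs = rotate l xs"
    using assms by (auto simp: cycle_class_def)
  with assms ne have "xs ! (k mod length xs) = xs ! (l mod length xs)"
    by (simp add: hd_rotate_conv_nth)
  then have "k mod length xs = l mod length xs"
    using ne by (simp add: nth_eq_iff_index_eq)
  then show ?thesis
    unfolding k l by (metis rotate_conv_mod)
qed

lemma reverse_cycle_class: "reverse_cycle (cycle_class xs) = cycle_class (rev xs)"
proof -
  have sub: "rev ` cycle_class xs \<subseteq> cycle_class (rev xs)" for xs :: "'a list"
  proof
    fix ys assume "ys \<in> rev ` cycle_class xs"
    then obtain k where "ys = rev (rotate k xs)"
      by (auto simp: cycle_class_def)
    also have "\<dots> = rotate (length xs - k mod length xs) (rev xs)"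
      using rotate_rev[of k "rev xs"] by (metis length_rev rev_rev_ident)
    finally show "ys \<in> cycle_class (rev xs)"
      by (auto simp: cycle_class_def)
  qed
  \<comment> \<open>Reversal is an involution, so the inclusion for \<open>rev xs\<close> yields the
    converse one.\<close>
  have "rev ` rev ` cycle_class (rev xs) \<subseteq> rev ` cycle_class (rev (rev xs))"
    using sub[of "rev xs"] by (rule image_mono)
  then show ?thesis
    unfolding reverse_cycle_def using sub[of xs] by (auto simp: image_image)
qed

lemma finite_cycle_class: "finite (cycle_class (xs :: 's::finite list))"
  by (rule finite_subset[OF _ finite_lists_length_eq[of UNIV "length xs"]])
    (auto simp: mem_cycle_class)

definition all_cycles :: "'s list set set" where
  "all_cycles = cycle_class ` simple_lists"

lemma finite_all_cycles: "finite (all_cycles :: 's::finite list set set)"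
  by (simp add: all_cycles_def finite_simple_lists)

lemma sum_simple_lists_by_cycle:
  "(\<Sum>xs\<in>simple_lists. f (xs :: 's::finite list)) = (\<Sum>c\<in>all_cycles. \<Sum>xs\<in>c. (f xs :: real))"
proof -
  have "{xs \<in> simple_lists. cycle_class xs = c} = c" if "c \<in> all_cycles" for c :: "'s list set"
    using that self_in_cycle_class cycle_class_eq mem_cycle_class(4)
    unfolding all_cycles_def by blast
  moreover have "(\<Sum>xs\<in>simple_lists. f xs) =
      (\<Sum>c\<in>all_cycles. \<Sum>xs | xs \<in> simple_lists \<and> cycle_class xs = c. f xs)"
    by (rule sum.group[symmetric]) (auto simp: finite_simple_lists finite_all_cycles all_cycles_def)
  ultimately show ?thesis
    by simp
qed

section \<open>Steps of the derived chain as operations on simple lists\<close>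

abbreviation next_path :: "'s list \<Rightarrow> 's \<Rightarrow> 's list" where
  "next_path \<eta> j \<equiv> takeWhile (\<lambda>y. y \<noteq> j) \<eta> @ [j]"

abbreviation forms :: "'s list set \<Rightarrow> 's list \<Rightarrow> 's \<Rightarrow> bool" where
  "forms c \<eta> j \<equiv> j \<in> set \<eta> \<and> c = cycle_class (dropWhile (\<lambda>y. y \<noteq> j) \<eta>)"

definition simple_lists_from :: "'s \<Rightarrow> 's list set" where
  "simple_lists_from a = {\<eta> \<in> simple_lists. hd \<eta> = a}"

lemma finite_simple_lists_from: "finite (simple_lists_from (a :: 's::finite))"
  by (simp add: simple_lists_from_def finite_simple_lists)

lemma hd_next_path: "\<eta> \<noteq> [] \<Longrightarrow> hd (next_path \<eta> j) = hd \<eta>"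
  by (cases \<eta>) auto

lemma next_path_simple: "\<eta> \<in> simple_lists \<Longrightarrow> next_path \<eta> j \<in> simple_lists"
  by (auto simp: simple_lists_def dest: set_takeWhileD)

lemma next_path_from: "\<eta> \<in> simple_lists_from a \<Longrightarrow> next_path \<eta> j \<in> simple_lists_from a"
  using next_path_simple[of \<eta> j] hd_next_path[of \<eta> j]
  by (auto simp: simple_lists_from_def) (auto simp: simple_lists_def)

lemma takeWhile_not_in: "j \<notin> set us \<Longrightarrow> takeWhile (\<lambda>y. y \<noteq> j) us = us"
  by (induction us) auto

lemma takeWhile_in: "j \<notin> set us \<Longrightarrow> takeWhile (\<lambda>y. y \<noteq> j) (us @ j # vs) = us"
  by (induction us) auto

lemma dropWhile_in: "j \<notin> set us \<Longrightarrow> dropWhile (\<lambda>y. y \<noteq> j) (us @ j # vs) = j # vs"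
  by (induction us) auto

section \<open>The invariant mass of the derived chain\<close>

lemma simple_paths_to_singleton: "simple_paths_to {i :: 'a} = {xs \<in> simple_lists. last xs = i}"
proof -
  have *: "last xs \<notin> set (butlast xs)" if "distinct xs" for xs :: "'a list"
    using that by (cases xs rule: rev_cases) auto
  then show ?thesis
    by (auto simp: simple_paths_to_def simple_lists_def dest: *)
qed

context stochastic_kernel begin

text \<open>Rotations index the edges, so the product belongs to the cycle and involves no choice of
  a starting state.\<close>

definition cycle_prod :: "'s list set \<Rightarrow> real" where
  "cycle_prod c = (\<Prod>xs\<in>c. m (last xs) (hd xs))"

text \<open>Shown below to be the probability that \<open>c\<close> is the single attractor and,
  divided by \<open>forest_total\<close>, the rate at which \<open>c\<close> is formed.\<close>

definition cycle_mass :: "'s list set \<Rightarrow> real" where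
  "cycle_mass c = cycle_prod c * forest (\<Union> (set ` c))"

text \<open>When positive, it normalizes \<open>forest {i}\<close> to a stationary distribution
  (Markov chain tree theorem).\<close>

definition forest_total :: real where
  "forest_total = (\<Sum>i\<in>UNIV. forest {i})"

text \<open>The unnormalized invariant mass of the derived chain.\<close>

definition path_mass :: "'s list \<Rightarrow> real" where
  "path_mass \<eta> = path_weight \<eta> * forest (set \<eta>)"

lemma path_weight_eq_prod: "path_weight xs = (\<Prod>k<length xs - 1. m (xs ! k) (xs ! Suc k))"
  by (induction xs rule: path_weight.induct) (auto simp del: prod.lessThan_Suc simp: prod.lessThan_Suc_shift)

lemma path_weight_closed:
  assumes "xs \<in> simple_lists"
  shows "path_weight (xs @ [hd xs]) = cycle_prod (cycle_class xs)"
proof -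
  have "cycle_prod (cycle_class xs) =
      (\<Prod>k<length xs. m (last (rotate (Suc k) xs)) (hd (rotate (Suc k) xs)))"
    unfolding cycle_prod_def
    by (rule prod.reindex_bij_betw[OF bij_betw_rotate_cycle_class[OF assms], symmetric])
  also have "\<dots> = (\<Prod>k<length xs. m ((xs @ [hd xs]) ! k) ((xs @ [hd xs]) ! Suc k))"
  proof (rule prod.cong[OF refl])
    fix k assume "k \<in> {..<length xs}"
    then have k: "k < length xs"
      by simp
    then have "(xs @ [hd xs]) ! k = xs ! k"
      by (simp add: nth_append)
    then show "m (last (rotate (Suc k) xs)) (hd (rotate (Suc k) xs)) =
        m ((xs @ [hd xs]) ! k) ((xs @ [hd xs]) ! Suc k)"
      by (simp only: hd_rotate_Suc[OF k] last_rotate_Suc[OF k] nth_closed_path[OF k])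
  qed
  finally show ?thesis
    by (simp add: path_weight_eq_prod)
qed

lemma path_weight_times_last:
  assumes "xs \<in> simple_lists"
  shows "path_weight xs * m (last xs) (hd xs) = cycle_prod (cycle_class xs)"
  using assms path_weight_append[of xs "[hd xs]"] path_weight_closed[OF assms]
  by (simp add: simple_lists_def)

lemma cycle_mass_class: "cycle_mass (cycle_class xs) = cycle_prod (cycle_class xs) * forest (set xs)"
  by (simp only: cycle_mass_def Union_cycle_class)

lemma cycle_prod_nonneg: "0 \<le> cycle_prod c"
  unfolding cycle_prod_def by (intro prod_nonneg) (simp add: nonneg)

lemma cycle_mass_nonneg: "0 \<le> cycle_mass c"
  unfolding cycle_mass_def by (intro mult_nonneg_nonneg cycle_prod_nonneg forest_nonneg)

text \<open>For an edge from \<open>i\<close> to \<open>j\<close>, the path expansion of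
  \<open>forest {i}\<close> is started at \<open>j\<close>. Its paths run from \<open>j\<close> to
  \<open>i\<close>, and the edge closes each into a cycle with that edge marked: the circulation
  identity, weighted by \<open>\<phi>\<close>.\<close>

lemma sum_forest_edges:
  "(\<Sum>i\<in>UNIV. \<Sum>j\<in>UNIV. forest {i} * m i j * \<phi> i j) =
    (\<Sum>xs\<in>simple_lists. cycle_mass (cycle_class xs) * \<phi> (last xs) (hd xs))"
proof -
  let ?f = "\<lambda>xs. cycle_mass (cycle_class xs) * \<phi> (last xs) (hd xs)"
  have "forest {i} * m i j * \<phi> i j = (\<Sum>xs | xs \<in> {xs \<in> simple_lists. last xs = i} \<and> hd xs = j. ?f xs)" for i j
    unfolding forest_eq_sum_paths[of "{i}" j] sum_distrib_right simple_paths_to_singleton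
  proof (rule sum.cong[OF refl])
    fix xs assume "xs \<in> {xs. xs \<in> {xs \<in> simple_lists. last xs = i} \<and> hd xs = j}"
    then have xs: "xs \<in> simple_lists" "last xs = i" "hd xs = j"
      by auto
    then have "{i} \<union> set xs = set xs"
      by (auto simp: simple_lists_def)
    then show "path_weight xs * forest ({i} \<union> set xs) * m i j * \<phi> i j = ?f xs"
      using path_weight_times_last[OF xs(1)] xs
      by (simp add: cycle_mass_class ac_simps flip: path_weight_times_last)
  qed
  then have "(\<Sum>i\<in>UNIV. \<Sum>j\<in>UNIV. forest {i} * m i j * \<phi> i j) =
      (\<Sum>i\<in>UNIV. \<Sum>j\<in>UNIV. \<Sum>xs | xs \<in> {xs \<in> simple_lists. last xs = i} \<and> hd xs = j. ?f xs)"
    by simp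
  also have "\<dots> = (\<Sum>i\<in>UNIV. \<Sum>xs\<in>{xs \<in> simple_lists. last xs = i}. ?f xs)"
    by (intro sum.cong refl sum.group) (auto intro: rev_finite_subset[OF finite_simple_lists])
  also have "\<dots> = (\<Sum>xs\<in>simple_lists. ?f xs)"
    by (rule sum.group) (auto simp: finite_simple_lists)
  finally show ?thesis .
qed

text \<open>Rotating a list by one step keeps its cycle and moves the head to the end, so in the
  cycle representation the flow into a state equals the flow out of it.\<close>

lemma forest_stationary:
  "(\<Sum>i\<in>UNIV. \<Sum>j\<in>UNIV. forest {i} * m i j * h j) = (\<Sum>i\<in>UNIV. forest {i} * h i)"
proof -
  have bij: "bij_betw rotate1 simple_lists (simple_lists :: 's list set)"
  proof (rule bij_betw_byWitness[where f' = "\<lambda>xs. rotate (length xs - 1) xs"])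
    show "\<forall>xs\<in>simple_lists. rotate (length (rotate1 xs) - 1) (rotate1 xs) = (xs :: 's list)"
    proof
      fix xs :: "'s list" assume "xs \<in> simple_lists"
      then have "Suc (length xs - 1) = length xs"
        by (simp add: simple_lists_def)
      moreover have "rotate (length xs - 1) (rotate1 xs) = rotate (Suc (length xs - 1)) xs"
        by (simp only: rotate_Suc rotate1_rotate_swap)
      ultimately show "rotate (length (rotate1 xs) - 1) (rotate1 xs) = xs"
        by simp
    qed
    show "\<forall>xs\<in>simple_lists. rotate1 (rotate (length xs - 1) xs) = (xs :: 's list)"
    proof
      fix xs :: "'s list" assume "xs \<in> simple_lists"
      then have "Suc (length xs - 1) = length xs"
        by (simp add: simple_lists_def)
      moreover have "rotate1 (rotate (length xs - 1) xs) = rotate (Suc (length xs - 1)) xs"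
        by (simp only: rotate_Suc)
      ultimately show "rotate1 (rotate (length xs - 1) xs) = xs"
        by simp
    qed
  qed (auto simp: simple_lists_def)
  have "(\<Sum>i\<in>UNIV. \<Sum>j\<in>UNIV. forest {i} * m i j * h j) =
      (\<Sum>xs\<in>simple_lists. cycle_mass (cycle_class xs) * h (hd xs))"
    by (rule sum_forest_edges)
  also have "\<dots> = (\<Sum>xs\<in>simple_lists. cycle_mass (cycle_class (rotate1 xs)) * h (last (rotate1 xs)))"
    by (rule sum.cong) (auto simp: cycle_class_rotate1 last_rotate1 simple_lists_def)
  also have "\<dots> = (\<Sum>xs\<in>simple_lists. cycle_mass (cycle_class xs) * h (last xs))"
    by (rule sum.reindex_bij_betw[OF bij])
  also have "\<dots> = (\<Sum>i\<in>UNIV. \<Sum>j\<in>UNIV. forest {i} * m i j * h i)"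
    by (rule sum_forest_edges[symmetric])
  also have "\<dots> = (\<Sum>i\<in>UNIV. (\<Sum>j\<in>UNIV. m i j) * (forest {i} * h i))"
    unfolding sum_distrib_right by (simp add: ac_simps)
  finally show ?thesis
    by (simp add: row_sum)
qed

text \<open>The paths from \<open>a\<close> that end at \<open>i\<close> carry the expansion of
  \<open>forest {i}\<close> from \<open>a\<close>. As a result the normalizer, and with it each
  formation rate, is the same for all starting states.\<close>

lemma sum_path_mass: "(\<Sum>\<eta>\<in>simple_lists_from a. path_mass \<eta>) = forest_total"
proof -
  have "forest {i} = (\<Sum>\<eta> | \<eta> \<in> simple_lists_from a \<and> last \<eta> = i. path_mass \<eta>)" for i
    unfolding forest_eq_sum_paths[of "{i}" a] simple_paths_to_singleton
    by (rule sum.cong) (auto simp: simple_lists_from_def path_mass_def simple_lists_def insert_absorb)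
  then show ?thesis
    unfolding forest_total_def
    by (simp add: sum.group[OF finite_simple_lists_from])
qed

lemma forest_empty: "forest {} = 0"
proof -
  have "\<not> hits \<alpha> {} x" for \<alpha> :: "'s \<Rightarrow> 's" and x
    using hits_closed[of \<alpha> "{}" x UNIV] by auto
  then show ?thesis
    by (simp add: forest_def flows_def map_prob_def)
qed

text \<open>The predecessors of \<open>us @ [i]\<close> are \<open>us\<close> and its extensions \<open>us @ i # vs\<close>, which match the
  two terms of \<open>forest_insert\<close>.\<close>

lemma path_mass_next_path:
  assumes "\<zeta> \<in> simple_lists_from a"
  shows "(\<Sum>(\<eta>, j) \<in> {p \<in> simple_lists_from a \<times> UNIV. (case p of (\<eta>, j) \<Rightarrow> next_path \<eta> j) = \<zeta>}.
    path_mass \<eta> * m (last \<eta>) j) = path_mass \<zeta>" (is "sum ?f ?S = _")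
proof -
  define us i where "us = butlast \<zeta>" and "i = last \<zeta>"
  have \<zeta>: "\<zeta> = us @ [i]" and dist: "distinct us" "i \<notin> set us" and hd: "hd (us @ [i]) = a"
    using assms unfolding us_def i_def simple_lists_from_def simple_lists_def
    by (cases \<zeta> rule: rev_cases; auto)+
  let ?V = "{vs. distinct (i # vs) \<and> set (i # vs) \<inter> set us = {}}"
  let ?g = "\<lambda>vs. (us @ i # vs, i)"
  \<comment> \<open>The derived chain is never empty, so \<open>us = []\<close> is not a
    predecessor; the formula stays uniform because \<open>forest {} = 0\<close>.\<close>
  let ?T = "if us = [] then {} else {(us, i)}"
  have S: "?S = ?T \<union> ?g ` ?V"
  proof (intro equalityI subsetI)
    fix p assume "p \<in> ?S"
    then obtain \<eta> j where p: "p = (\<eta>, j)" and \<eta>: "\<eta> \<in> simple_lists_from a"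
      and nx: "next_path \<eta> j = us @ [i]"
      by (auto simp: \<zeta>)
    have j: "j = i" and us: "takeWhile (\<lambda>y. y \<noteq> j) \<eta> = us"
      using nx by auto
    show "p \<in> ?T \<union> ?g ` ?V"
    proof (cases "j \<in> set \<eta>")
      case True
      then obtain us' vs where "\<eta> = us' @ j # vs" "j \<notin> set us'"
        by (metis split_list_first)
      moreover from this have "us' = us"
        using nx by (simp add: takeWhile_in)
      ultimately have vs: "\<eta> = us @ i # vs"
        by (simp add: j)
      then have "vs \<in> ?V"
        using \<eta> by (auto simp: simple_lists_from_def simple_lists_def)
      then show ?thesis
        by (simp add: p j vs)
    next
      case False
      then have "us = \<eta>"
        using nx by (simp add: takeWhile_not_in)
      then show ?thesis
        using \<eta> by (auto simp: p j simple_lists_from_def simple_lists_def)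
    qed
  next
    fix p assume "p \<in> ?T \<union> ?g ` ?V"
    then show "p \<in> ?S"
      using dist hd
      by (auto simp: \<zeta> simple_lists_from_def simple_lists_def takeWhile_in hd_append split: if_splits)
  qed
  have "finite ?V"
    by (rule finite_subset[OF _ finite_distinct_lists]) auto
  have "sum ?f ?S = sum ?f ?T + sum ?f (?g ` ?V)"
    unfolding S using \<open>finite ?V\<close> by (intro sum.union_disjoint) auto
  also have "sum ?f ?T = path_weight (us @ [i]) * forest (set us)"
    by (auto simp: path_mass_def path_weight_append forest_empty)
  also have "sum ?f (?g ` ?V) =
      path_weight (us @ [i]) * (\<Sum>vs\<in>?V. path_weight (i # vs @ [i]) * forest (set us \<union> set (i # vs)))"
  proof -
    have "path_mass (us @ i # vs) * m (last (us @ i # vs)) i =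
        path_weight (us @ [i]) * (path_weight (i # vs @ [i]) * forest (set us \<union> set (i # vs)))" for vs
    proof -
      have "path_weight (i # vs @ [i]) = path_weight (i # vs) * m (last (i # vs)) i"
        using path_weight_append[of "i # vs" "[i]"] by simp
      then show ?thesis
        by (simp add: path_mass_def path_weight_split[of us i vs] del: path_weight.simps)
    qed
    then show ?thesis
      by (subst sum.reindex) (auto simp: inj_on_def sum_distrib_left)
  qed
  also have "path_weight (us @ [i]) * forest (set us) + \<dots> = path_mass \<zeta>"
    using forest_insert[OF dist(2)] by (simp add: path_mass_def \<zeta> distrib_left)
  finally show ?thesis .
qed

text \<open>Grouping the transitions by target gives invariance of \<open>path_mass\<close> tested
  against arbitrary \<open>g\<close>.\<close>

lemma path_mass_stationary:
  "(\<Sum>\<eta>\<in>simple_lists_from a. \<Sum>j\<in>UNIV. path_mass \<eta> * m (last \<eta>) j * g (next_path \<eta> j)) =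
    (\<Sum>\<eta>\<in>simple_lists_from a. path_mass \<eta> * g \<eta>)"
proof -
  let ?L = "simple_lists_from a"
  let ?N = "\<lambda>(\<eta>, j). next_path \<eta> j"
  have "(\<Sum>\<eta>\<in>?L. \<Sum>j\<in>UNIV. path_mass \<eta> * m (last \<eta>) j * g (next_path \<eta> j)) =
      (\<Sum>(\<eta>, j)\<in>?L \<times> UNIV. path_mass \<eta> * m (last \<eta>) j * g (next_path \<eta> j))"
    by (rule sum.cartesian_product)
  also have "\<dots> = (\<Sum>\<zeta>\<in>?L. \<Sum>(\<eta>, j) \<in> {p \<in> ?L \<times> UNIV. ?N p = \<zeta>}.
      path_mass \<eta> * m (last \<eta>) j * g (next_path \<eta> j))"
    by (rule sum.group[symmetric]) (auto simp: finite_simple_lists_from next_path_from)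
  also have "\<dots> = (\<Sum>\<zeta>\<in>?L. (\<Sum>(\<eta>, j) \<in> {p \<in> ?L \<times> UNIV. ?N p = \<zeta>}.
      path_mass \<eta> * m (last \<eta>) j) * g \<zeta>)"
    unfolding sum_distrib_right by (intro sum.cong refl) auto
  also have "\<dots> = (\<Sum>\<zeta>\<in>?L. path_mass \<zeta> * g \<zeta>)"
    by (intro sum.cong refl) (simp only: path_mass_next_path)
  finally show ?thesis .
qed

text \<open>A path that forms \<open>c\<close> by a step to \<open>j\<close> splits into a simple
  path from \<open>a\<close> to its first state \<open>j\<close> on \<open>c\<close> and the
  rotation of \<open>c\<close> from \<open>j\<close>. With the closing step the rotation contributes
  \<open>cycle_prod c\<close>, and the initial paths sum to \<open>forest (set xs)\<close>.\<close>

lemma path_mass_forms: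
  assumes "xs \<in> simple_lists"
  defines "c \<equiv> cycle_class xs"
  shows "(\<Sum>\<eta>\<in>simple_lists_from a. \<Sum>j\<in>UNIV. path_mass \<eta> * m (last \<eta>) j * of_bool (forms c \<eta> j)) =
    cycle_mass c"
proof -
  let ?L = "simple_lists_from a"
  let ?S = "{(\<eta>, j). \<eta> \<in> ?L \<and> forms c \<eta> j}"
  let ?P = "{ys. ys \<in> simple_paths_to (set xs) \<and> hd ys = a}"
  define rot where "rot j = (THE zs. zs \<in> c \<and> hd zs = j)" for j
  have rot: "rot j \<in> c" "hd (rot j) = j" if "j \<in> set xs" for j
  proof -
    have "\<exists>!zs. zs \<in> c \<and> hd zs = j"
      using cycle_class_ex_hd[OF that] cycle_class_hd_inj[OF assms(1)] unfolding c_def by metis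
    from theI'[OF this] show "rot j \<in> c" "hd (rot j) = j"
      by (auto simp: rot_def)
  qed
  have rot_eq: "rot j = zs" if "zs \<in> c" "hd zs = j" for j zs
    using that cycle_class_hd_inj[OF assms(1)] unfolding rot_def c_def by (intro the_equality) auto
  have c: "zs \<noteq> []" "set zs = set xs" "distinct zs" "cycle_class zs = c" "zs \<in> simple_lists" if "zs \<in> c" for zs
    using that assms mem_cycle_class[of zs xs] cycle_class_eq[of zs xs]
    by (auto simp: simple_lists_def)
  have "(\<Sum>\<eta>\<in>?L. \<Sum>j\<in>UNIV. path_mass \<eta> * m (last \<eta>) j * of_bool (forms c \<eta> j)) =
      (\<Sum>(\<eta>, j)\<in>?L \<times> UNIV. path_mass \<eta> * m (last \<eta>) j * of_bool (forms c \<eta> j))"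
    by (rule sum.cartesian_product)
  also have "\<dots> = (\<Sum>(\<eta>, j)\<in>?S. path_mass \<eta> * m (last \<eta>) j)"
    by (rule sum.mono_neutral_cong_right) (auto simp: finite_simple_lists_from)
  also have "\<dots> = (\<Sum>ys\<in>?P. cycle_prod c * (path_weight ys * forest (set xs \<union> set ys)))"
  \<comment> \<open>A path entering \<open>c\<close> at \<open>last ys\<close> is completed by the
    rotation from there; conversely \<open>next_path\<close> cuts off everything after the revisited
    state.\<close>
  proof (rule sum.reindex_bij_witness[where i = "\<lambda>ys. (butlast ys @ rot (last ys), last ys)"
        and j = "\<lambda>(\<eta>, j). next_path \<eta> j"])
    fix p assume "p \<in> ?S"
    then obtain \<eta> j where p: "p = (\<eta>, j)" and \<eta>: "\<eta> \<in> ?L" and j: "j \<in> set \<eta>"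
      and cj: "c = cycle_class (dropWhile (\<lambda>y. y \<noteq> j) \<eta>)"
      by auto
    obtain us vs where vs: "\<eta> = us @ j # vs" "j \<notin> set us"
      using j by (metis split_list_first)
    then have c': "j # vs \<in> c"
      using cj self_in_cycle_class[of "j # vs"] by (simp add: dropWhile_in)
    have dist: "distinct (us @ j # vs)" and hd: "hd (us @ j # vs) = a"
      using \<eta> by (auto simp: simple_lists_from_def simple_lists_def vs)
    have set: "set xs = set (j # vs)"
      using c(2)[OF c'] by simp
    have r: "rot j = j # vs"
      by (rule rot_eq[OF c']) simp
    show "(\<lambda>ys. (butlast ys @ rot (last ys), last ys)) (case p of (\<eta>, j) \<Rightarrow> next_path \<eta> j) = p"
      by (simp add: p vs takeWhile_in r)
    show "(case p of (\<eta>, j) \<Rightarrow> next_path \<eta> j) \<in> ?P"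
      using dist hd vs(2) by (auto simp: p vs takeWhile_in simple_paths_to_def set hd_append)
    have cp: "cycle_prod c = path_weight (j # vs) * m (last (j # vs)) j"
      using path_weight_times_last[OF c(5)[OF c']] c(4)[OF c'] by simp
    have "set xs \<union> set (us @ [j]) = set \<eta>"
      by (auto simp: set vs)
    moreover have "path_weight \<eta> = path_weight (us @ [j]) * path_weight (j # vs)"
      unfolding vs(1) by (rule path_weight_split)
    moreover have nx: "next_path \<eta> j = us @ [j]"
      using vs by (simp add: takeWhile_in)
    moreover have "last \<eta> = last (j # vs)"
      by (simp add: vs)
    ultimately show "cycle_prod c * (path_weight (case p of (\<eta>, j) \<Rightarrow> next_path \<eta> j) *
        forest (set xs \<union> set (case p of (\<eta>, j) \<Rightarrow> next_path \<eta> j))) =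
      (case p of (\<eta>, j) \<Rightarrow> path_mass \<eta> * m (last \<eta>) j)"
      using nx by (simp only: p prod.case path_mass_def cp ac_simps)
  next
    fix ys assume "ys \<in> ?P"
    then have ys: "ys \<noteq> []" "distinct ys" "last ys \<in> set xs" "set (butlast ys) \<inter> set xs = {}" "hd ys = a"
      by (auto simp: simple_paths_to_def)
    define us j where "us = butlast ys" and "j = last ys"
    have eq: "ys = us @ [j]"
      using ys by (simp add: us_def j_def)
    obtain vs where vs: "rot j = j # vs"
      using rot[of j] ys(3) c(1)[of "rot j"] by (cases "rot j") (auto simp: j_def)
    have rc: "j # vs \<in> c"
      using rot[of j] ys(3) vs by (simp add: j_def)
    have j: "j \<notin> set us"
      using ys(2) by (simp add: eq)
    show "(case (butlast ys @ rot (last ys), last ys) of (\<eta>, j) \<Rightarrow> next_path \<eta> j) = ys"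
      using j by (simp add: eq vs takeWhile_in)
    have "distinct (us @ j # vs)"
      using ys(2,4) c(2,3)[OF rc] by (auto simp: eq)
    moreover have "hd (us @ j # vs) = a"
      using ys(5) by (auto simp: eq hd_append split: if_splits)
    ultimately show "(butlast ys @ rot (last ys), last ys) \<in> ?S"
      using j c(4)[OF rc] by (simp add: eq vs dropWhile_in simple_lists_from_def simple_lists_def)
  qed
  also have "\<dots> = cycle_prod c * forest (set xs)"
    unfolding forest_eq_sum_paths[of "set xs" a] by (simp add: sum_distrib_left)
  also have "\<dots> = cycle_mass c"
    by (simp add: c_def cycle_mass_class)
  finally show ?thesis .
qed

end

section \<open>Attractors\<close>

definition closed_orbit :: "('s \<Rightarrow> 's) \<Rightarrow> 's list \<Rightarrow> bool" where
  "closed_orbit \<alpha> xs \<longleftrightarrow> xs \<in> simple_lists \<and> follows \<alpha> (xs @ [hd xs])"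

lemma closed_orbit_iff:
  "closed_orbit \<alpha> xs \<longleftrightarrow> xs \<in> simple_lists \<and> (\<forall>ys\<in>cycle_class xs. \<alpha> (last ys) = hd ys)"
  unfolding closed_orbit_def by (auto simp: successively_closed_path)

lemma periodic_orbits_eq: "periodic_orbits \<alpha> = cycle_class ` {xs. closed_orbit \<alpha> xs}"
proof -
  have "closed_orbit \<alpha> xs \<longleftrightarrow> xs \<noteq> [] \<and> distinct xs \<and>
      (\<forall>k<length xs. \<alpha> (xs ! k) = xs ! (Suc k mod length xs))" for xs
    using all_cycle_edges_iff[of xs "\<lambda>x y. \<alpha> x = y"]
    unfolding closed_orbit_iff by (auto simp: simple_lists_def)
  then show ?thesis
    unfolding periodic_orbits_def by (auto simp: image_def)
qed

lemma closed_orbit_class: "ys \<in> cycle_class xs \<Longrightarrow> closed_orbit \<alpha> ys \<longleftrightarrow> closed_orbit \<alpha> xs"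
  by (simp add: closed_orbit_iff mem_cycle_class cycle_class_eq)

lemma closed_orbit_image:
  assumes "closed_orbit \<alpha> xs" "x \<in> set xs"
  shows "\<alpha> x \<in> set xs"
proof -
  obtain ys where ys: "ys \<in> cycle_class xs" "hd ys = x"
    using cycle_class_ex_hd[OF assms(2)] by auto
  have ne: "ys \<noteq> []"
    using mem_cycle_class(1)[OF ys(1)] assms(2) by auto
  have mem: "rotate1 ys \<in> cycle_class xs"
    using ys(1) by (metis cycle_class_eq cycle_class_rotate1 self_in_cycle_class)
  then have "\<alpha> x = hd (rotate1 ys)"
    using assms(1) ys(2) last_rotate1[OF ne] by (auto simp: closed_orbit_iff)
  moreover have "hd (rotate1 ys) \<in> set (rotate1 ys)"
    using ne by (intro hd_in_set) auto
  ultimately show ?thesis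
    using mem_cycle_class(1)[OF mem] by simp
qed

text \<open>The orbit of \<open>y\<close> stays on its cycle, so the two cycles share a state
  \<open>z\<close>; the common map then determines the way from \<open>z\<close> back to
  \<open>z\<close>.\<close>

lemma closed_orbit_unique:
  assumes xs: "closed_orbit \<alpha> xs" and ys: "closed_orbit \<alpha> ys"
    and hit: "hits \<alpha> (set xs) y" "y \<in> set ys"
  shows "cycle_class xs = cycle_class ys"
proof -
  obtain z where z: "z \<in> set xs" "z \<in> set ys"
    using hits_closed[OF hit] closed_orbit_image[OF ys] by blast
  obtain xs' ys' where xs': "xs' \<in> cycle_class xs" "hd xs' = z" and ys': "ys' \<in> cycle_class ys" "hd ys' = z"
    using cycle_class_ex_hd z by metis
  \<comment> \<open>The return path is started at \<open>\<alpha> z\<close>, since the first-entry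
    path from \<open>z\<close> to \<open>{z}\<close> is just \<open>[z]\<close>.\<close>
  have path: "\<exists>vs. zs = z # vs \<and> vs @ [z] \<in> simple_paths_to {z} \<and> follows \<alpha> (vs @ [z]) \<and> hd (vs @ [z]) = \<alpha> z"
    if zs: "closed_orbit \<alpha> zs" "hd zs = z" for zs
  proof -
    obtain vs where "zs = z # vs"
      using zs by (cases zs) (auto simp: closed_orbit_def simple_lists_def)
    then show ?thesis
      using that by (auto simp: closed_orbit_def simple_lists_def simple_paths_to_def successively_Cons)
  qed
  have "closed_orbit \<alpha> xs'" "closed_orbit \<alpha> ys'"
    using xs ys closed_orbit_class[OF xs'(1)] closed_orbit_class[OF ys'(1)] by auto
  then have "xs' = ys'"
    using path[of xs'] path[of ys'] xs'(2) ys'(2) follows_path_unique by fastforce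
  then show ?thesis
    using xs' ys' cycle_class_eq by metis
qed

text \<open>A longest simple orbit segment from \<open>x\<close> must be continued by one of its own
  states; the part from that state on is periodic.\<close>

lemma hits_closed_orbit:
  fixes \<alpha> :: "'s::finite \<Rightarrow> 's"
  obtains zs where "closed_orbit \<alpha> zs" "hits \<alpha> (set zs) x"
proof -
  let ?S = "{ys \<in> simple_lists_from x. follows \<alpha> ys}"
  have fin: "finite (length ` ?S)"
    by (intro finite_imageI rev_finite_subset[OF finite_simple_lists_from]) auto
  have "[x] \<in> ?S"
    by (simp add: simple_lists_from_def simple_lists_def)
  then have "length ` ?S \<noteq> {}"
    by blast
  from Max_in[OF fin this] obtain ys where ys: "ys \<in> ?S" and "length ys = Max (length ` ?S)"
    by (metis (no_types, lifting) imageE)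
  then have max: "length zs \<le> length ys" if "zs \<in> ?S" for zs
    using Max_ge[OF fin imageI[OF that]] by simp
  have ne: "ys \<noteq> []" and hd: "hd ys = x" and dist: "distinct ys" and fol: "follows \<alpha> ys"
    using ys by (auto simp: simple_lists_from_def simple_lists_def)
  have "\<alpha> (last ys) \<in> set ys"
  proof (rule ccontr)
    assume "\<alpha> (last ys) \<notin> set ys"
    then have "ys @ [\<alpha> (last ys)] \<in> ?S"
      using ne hd dist fol by (auto simp: simple_lists_from_def simple_lists_def successively_append_iff)
    from max[OF this] show False
      by simp
  qed
  then obtain us zs where ys_eq: "ys = us @ zs" and zs: "zs \<noteq> []" "hd zs = \<alpha> (last ys)"
    by (metis list.distinct(1) list.sel(1) split_list)
  have last: "last zs = last ys"
    using zs by (simp add: ys_eq)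
  show ?thesis
  proof (rule that[of zs])
    show "closed_orbit \<alpha> zs"
      using dist fol zs(1) zs(2)[folded last]
      by (auto simp: ys_eq closed_orbit_def simple_lists_def successively_append_iff)
    show "hits \<alpha> (set zs) x"
      using follows_hits[OF fol, of x "set zs"] ne hd last zs(1) by (metis hd_in_set last_in_set)
  qed
qed

text \<open>Every orbit runs into some periodic orbit and different periodic orbits are disjoint, so
  uniqueness of the cycle is the same as its being reached from everywhere.\<close>

lemma attractor_eq_iff:
  fixes \<alpha> :: "'s::finite \<Rightarrow> 's"
  assumes "xs \<in> simple_lists"
  shows "attractor \<alpha> = cycle_class xs \<longleftrightarrow> flows \<alpha> (set xs) \<and> follows \<alpha> (xs @ [hd xs])"
proof
  assume "attractor \<alpha> = cycle_class xs"
  then have single: "single_attractor \<alpha>" and "(THE c. c \<in> periodic_orbits \<alpha>) = cycle_class xs"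
    using self_in_cycle_class[of xs] by (auto simp: attractor_def split: if_splits)
  then have mem: "cycle_class xs \<in> periodic_orbits \<alpha>" and uniq: "\<And>c. c \<in> periodic_orbits \<alpha> \<Longrightarrow> c = cycle_class xs"
    unfolding single_attractor_def by (metis theI')+
  from mem have "closed_orbit \<alpha> xs"
    unfolding periodic_orbits_eq using closed_orbit_class cycle_class_eq_iff by blast
  moreover have "hits \<alpha> (set xs) x" for x
  proof -
    obtain zs where zs: "closed_orbit \<alpha> zs" "hits \<alpha> (set zs) x"
      by (rule hits_closed_orbit)
    then have "cycle_class zs = cycle_class xs"
      by (intro uniq) (auto simp: periodic_orbits_eq)
    then have "set zs = set xs"
      using self_in_cycle_class[of zs] mem_cycle_class(1) by blast
    then show ?thesis
      using zs by simp
  qed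
  ultimately show "flows \<alpha> (set xs) \<and> follows \<alpha> (xs @ [hd xs])"
    by (simp add: flows_def closed_orbit_def)
next
  assume A: "flows \<alpha> (set xs) \<and> follows \<alpha> (xs @ [hd xs])"
  then have orb: "closed_orbit \<alpha> xs"
    using assms by (simp add: closed_orbit_def)
  have "c = cycle_class xs" if c: "c \<in> periodic_orbits \<alpha>" for c
  proof -
    obtain ys where ys: "closed_orbit \<alpha> ys" "c = cycle_class ys"
      using c by (auto simp: periodic_orbits_eq)
    have "hits \<alpha> (set xs) (hd ys)" "hd ys \<in> set ys"
      using A ys(1) by (auto simp: flows_def closed_orbit_def simple_lists_def)
    with closed_orbit_unique[OF orb ys(1)] ys(2) show ?thesis
      by simp
  qed
  moreover have "cycle_class xs \<in> periodic_orbits \<alpha>"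
    using orb by (auto simp: periodic_orbits_eq)
  ultimately have "periodic_orbits \<alpha> = {cycle_class xs}"
    by blast
  then have "single_attractor \<alpha>" "(THE c. c \<in> periodic_orbits \<alpha>) = cycle_class xs"
    by (simp_all add: single_attractor_def)
  then show "attractor \<alpha> = cycle_class xs"
    by (simp add: attractor_def)
qed

context stochastic_kernel begin

text \<open>The map has to follow \<open>c\<close> on its states and lead the other states into it.
  These conditions concern different coordinates, so their probabilities multiply.\<close>

lemma map_prob_attractor:
  assumes "c \<in> all_cycles"
  shows "map_prob {\<alpha>. attractor \<alpha> = c} = cycle_mass c"
proof -
  obtain xs where xs: "xs \<in> simple_lists" "c = cycle_class xs"
    using assms by (auto simp: all_cycles_def)
  have "map_prob {\<alpha>. attractor \<alpha> = c} = map_prob {\<alpha>. flows \<alpha> (set xs) \<and> follows \<alpha> (xs @ [hd xs])}"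
    by (simp add: xs attractor_eq_iff)
  also have "\<dots> = path_weight (xs @ [hd xs]) * forest (set xs)"
    using xs(1) by (intro forest_follows) (auto simp: simple_lists_def)
  also have "\<dots> = cycle_mass c"
    by (simp only: path_weight_closed[OF xs(1)] xs(2) cycle_mass_class)
  finally show ?thesis .
qed

lemma map_prob_single_attractor: "map_prob {\<alpha>. single_attractor \<alpha>} = (\<Sum>c\<in>all_cycles. cycle_mass c)"
proof -
  have cyc: "attractor \<alpha> \<in> all_cycles" if "single_attractor \<alpha>" for \<alpha> :: "'s \<Rightarrow> 's"
  proof -
    have "attractor \<alpha> \<in> periodic_orbits \<alpha>"
      using that theI'[of "\<lambda>c. c \<in> periodic_orbits \<alpha>"] by (simp add: attractor_def single_attractor_def)
    then show ?thesis
      by (auto simp: periodic_orbits_eq closed_orbit_def all_cycles_def)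
  qed
  \<comment> \<open>A rotation class is nonempty, so it differs from the default value
    \<open>{}\<close> of a map without single attractor.\<close>
  have "{\<alpha> \<in> {\<alpha>. single_attractor \<alpha>}. attractor \<alpha> = c} = {\<alpha>. attractor \<alpha> = c}" if "c \<in> all_cycles" for c :: "'s list set"
    using that self_in_cycle_class by (auto simp: attractor_def all_cycles_def)
  then have "(\<Sum>c\<in>all_cycles. map_prob {\<alpha>. attractor \<alpha> = c}) =
      (\<Sum>c\<in>all_cycles. \<Sum>\<alpha>\<in>{\<alpha> \<in> {\<alpha>. single_attractor \<alpha>}. attractor \<alpha> = c}. map_weight \<alpha>)"
    by (simp add: map_prob_def)
  also have "\<dots> = map_prob {\<alpha>. single_attractor \<alpha>}"
    unfolding map_prob_def by (rule sum.group) (auto simp: finite_all_cycles cyc)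
  finally show ?thesis
    by (simp add: map_prob_attractor)
qed

text \<open>It suffices to find one map of positive weight that leads every state to
  \<open>a\<close>: each other state moves along a positive edge to a state closer to
  \<open>a\<close>, and \<open>a\<close> itself moves along any positive edge.\<close>

lemma forest_total_pos:
  assumes "\<And>i. (i, a) \<in> {(i, j). 0 < m i j}\<^sup>*"
  shows "0 < forest_total"
proof -
  let ?E = "{(i, j). 0 < m i j}"
  define d where "d i = (LEAST n. (i, a) \<in> ?E ^^ n)" for i
  have d: "(i, a) \<in> ?E ^^ d i" for i
  proof -
    have "\<exists>n. (i, a) \<in> ?E ^^ n"
      using assms[of i] by (rule rtrancl_imp_relpow)
    then show ?thesis
      unfolding d_def by (rule LeastI_ex)
  qed
  have succ: "\<exists>j. 0 < m i j \<and> (i \<noteq> a \<longrightarrow> d j < d i)" for i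
  proof (cases "i = a")
    case True
    have "(\<Sum>j\<in>UNIV. m i j) \<noteq> 0"
      by (simp add: row_sum)
    then obtain j where "m i j \<noteq> 0"
      by (meson sum.neutral)
    then have "0 < m i j"
      using nonneg[of i j] by simp
    then show ?thesis
      using True by auto
  next
    case False
    then obtain n where n: "d i = Suc n"
      using d[of i] by (cases "d i") auto
    then obtain j where "(i, j) \<in> ?E" "(j, a) \<in> ?E ^^ n"
      using d[of i] by (metis relpow_Suc_D2)
    moreover from this have "d j \<le> n"
      unfolding d_def by (intro Least_le)
    ultimately show ?thesis
      using n by auto
  qed
  then obtain \<alpha> where \<alpha>: "\<And>i. 0 < m i (\<alpha> i)" "\<And>i. i \<noteq> a \<Longrightarrow> d (\<alpha> i) < d i"
    by metis
  have "hits \<alpha> {a} i" for i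
  proof (induction "d i" arbitrary: i rule: less_induct)
    case less
    then show ?case
      using \<alpha>(2)[of i] by (cases "i = a") (auto intro: hits.intros)
  qed
  then have "map_weight \<alpha> \<le> forest {a}"
    unfolding forest_def map_prob_def
    by (intro member_le_sum) (auto simp: flows_def map_weight_nonneg)
  moreover have "0 < map_weight \<alpha>"
    unfolding map_weight_def by (intro prod_pos) (simp add: \<alpha>)
  moreover have "forest {a} \<le> forest_total"
    unfolding forest_total_def by (intro member_le_sum) (auto simp: forest_nonneg)
  ultimately show ?thesis
    by linarith
qed

end

section \<open>A strong law for martingale differences\<close>

lemma sum_PiE_Suc:
  "(\<Sum>i\<in>{..Suc t} \<rightarrow>\<^sub>E (UNIV :: 's::finite set). F i) =
    (\<Sum>i\<in>{..t} \<rightarrow>\<^sub>E UNIV. \<Sum>j\<in>UNIV. (F (i(Suc t := j)) :: real))"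
proof -
  have "inj_on (\<lambda>(j, i). i(Suc t := j)) (UNIV \<times> ({..t} \<rightarrow>\<^sub>E (UNIV :: 's set)))"
    by (rule inj_combinator) simp
  then have "(\<Sum>i\<in>{..Suc t} \<rightarrow>\<^sub>E (UNIV :: 's set). F i) =
      (\<Sum>(j, i)\<in>UNIV \<times> ({..t} \<rightarrow>\<^sub>E UNIV). F (i(Suc t := j)))"
    unfolding atMost_Suc PiE_insert_eq by (subst sum.reindex) (auto intro!: sum.cong)
  also have "\<dots> = (\<Sum>j\<in>UNIV. \<Sum>i\<in>{..t} \<rightarrow>\<^sub>E UNIV. F (i(Suc t := j)))"
    by (rule sum.cartesian_product[symmetric])
  finally show ?thesis
    using sum.swap[of "\<lambda>j i. F (i(Suc t := j))"] by simp
qed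

text \<open>Adaptedness to the natural filtration, formulated for functionals of paths. On a finite
  state space their expectations are finite sums over cylinders.\<close>

definition depends_upto :: "nat \<Rightarrow> ((nat \<Rightarrow> 's) \<Rightarrow> real) \<Rightarrow> bool" where
  "depends_upto t \<Phi> \<longleftrightarrow> (\<forall>x y. (\<forall>s\<le>t. x s = y s) \<longrightarrow> \<Phi> x = \<Phi> y)"

lemma depends_uptoD: "depends_upto t \<Phi> \<Longrightarrow> (\<And>s. s \<le> t \<Longrightarrow> x s = y s) \<Longrightarrow> \<Phi> x = \<Phi> y"
  unfolding depends_upto_def by blast

lemma depends_upto_mono: "depends_upto s \<Phi> \<Longrightarrow> s \<le> t \<Longrightarrow> depends_upto t \<Phi>"
  unfolding depends_upto_def by (meson order_trans)

lemma depends_upto_mult: "depends_upto t \<Phi> \<Longrightarrow> depends_upto t \<Psi> \<Longrightarrow> depends_upto t (\<lambda>x. \<Phi> x * \<Psi> x)"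
  unfolding depends_upto_def by metis

lemma depends_upto_sum:
  fixes \<Phi> :: "'k \<Rightarrow> (nat \<Rightarrow> 's) \<Rightarrow> real"
  assumes "\<And>k. k \<in> A \<Longrightarrow> depends_upto t (\<Phi> k)"
  shows "depends_upto t (\<lambda>x. \<Sum>k\<in>A. \<Phi> k x)"
  unfolding depends_upto_def
proof (intro allI impI sum.cong refl)
  fix x y :: "nat \<Rightarrow> 's" and k assume "\<forall>s\<le>t. x s = y s" "k \<in> A"
  then show "\<Phi> k x = \<Phi> k y"
    using depends_uptoD[OF assms] by blast
qed

section \<open>Cylinder probabilities and expectations of path functionals\<close>

definition cylinder :: "'w measure \<Rightarrow> (nat \<Rightarrow> 'w \<Rightarrow> 's) \<Rightarrow> nat \<Rightarrow> (nat \<Rightarrow> 's) \<Rightarrow> 'w set" where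
  "cylinder P X t i = {\<omega> \<in> space P. \<forall>s\<le>t. X s \<omega> = i s}"

lemma cylinder_sets:
  assumes "markov_chain P X M"
  shows "cylinder P X t i \<in> sets P"
proof -
  have "X s \<in> measurable P (count_space UNIV)" for s
    using assms by (simp add: markov_chain_def)
  then have [measurable]: "{\<omega> \<in> space P. X s \<omega> = i s} \<in> sets P" for s
    by measurable
  have "cylinder P X t i = (\<Inter>s\<in>{..t}. {\<omega> \<in> space P. X s \<omega> = i s})"
    by (auto simp: cylinder_def)
  also have "\<dots> \<in> sets P"
    by (rule sets.finite_INT) auto
  finally show ?thesis .
qed

lemma cylinder_prob_Suc:
  fixes X :: "nat \<Rightarrow> 'w \<Rightarrow> 's::finite"
  assumes "markov_chain P X M"
  shows "measure P (cylinder P X (Suc t) i) = measure P (cylinder P X t i) * M $ i t $ i (Suc t)"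
proof -
  interpret prob_space P
    using assms by (simp add: markov_chain_def)
  have Suc: "cylinder P X (Suc t) i = {\<omega> \<in> space P. X (Suc t) \<omega> = i (Suc t) \<and> (\<forall>s\<le>t. X s \<omega> = i s)}"
    by (auto simp: cylinder_def le_Suc_eq)
  show ?thesis
  proof (cases "prob (cylinder P X t i) > 0")
    case True
    then have "cond_prob P (\<lambda>\<omega>. X (Suc t) \<omega> = i (Suc t)) (\<lambda>\<omega>. \<forall>s\<le>t. X s \<omega> = i s) = M $ i t $ i (Suc t)"
      using assms by (simp add: markov_chain_def cylinder_def)
    then show ?thesis
      using True unfolding cond_prob_def Suc by (simp add: cylinder_def field_simps)
  next
    case False
    \<comment> \<open>The Markov property is stated for cylinders of positive probability; inside a
      null cylinder both sides are 0.\<close>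
    then have "prob (cylinder P X t i) = 0"
      by (simp add: zero_less_measure_iff)
    moreover have "prob (cylinder P X (Suc t) i) \<le> prob (cylinder P X t i)"
      by (rule finite_measure_mono[OF _ cylinder_sets[OF assms]]) (auto simp: cylinder_def)
    ultimately show ?thesis
      using measure_nonneg[of P "cylinder P X (Suc t) i"] by simp
  qed
qed

lemma expectation_depends_upto:
  fixes X :: "nat \<Rightarrow> 'w \<Rightarrow> 's::finite"
  assumes "markov_chain P X M" "depends_upto t \<Phi>"
  shows "integrable P (\<lambda>\<omega>. \<Phi> (\<lambda>s. X s \<omega>))"
    and "integral\<^sup>L P (\<lambda>\<omega>. \<Phi> (\<lambda>s. X s \<omega>)) =
      (\<Sum>i\<in>{..t} \<rightarrow>\<^sub>E UNIV. measure P (cylinder P X t i) * \<Phi> i)"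
proof -
  interpret prob_space P
    using assms(1) by (simp add: markov_chain_def)
  let ?I = "{..t} \<rightarrow>\<^sub>E (UNIV :: 's set)"
  note [measurable] = cylinder_sets[OF assms(1)]
  have fin: "finite ?I"
    by (simp add: finite_PiE)
  have eq: "\<Phi> (\<lambda>s. X s \<omega>) = (\<Sum>i\<in>?I. indicat_real (cylinder P X t i) \<omega> * \<Phi> i)" if "\<omega> \<in> space P" for \<omega>
  proof -
    \<comment> \<open>Each \<omega> lies in exactly one cylinder of the family; restriction makes
      its path extensional, hence an element of \<open>?I\<close>.\<close>
    define i where "i = restrict (\<lambda>s. X s \<omega>) {..t}"
    have i: "i \<in> ?I"
      by (simp add: i_def)
    have "(\<Sum>k\<in>?I. indicat_real (cylinder P X t k) \<omega> * \<Phi> k) =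
        (\<Sum>k\<in>{i}. indicat_real (cylinder P X t k) \<omega> * \<Phi> k)"
    proof (rule sum.mono_neutral_right[OF fin])
      show "\<forall>k\<in>?I - {i}. indicat_real (cylinder P X t k) \<omega> * \<Phi> k = 0"
      proof
        fix k assume k: "k \<in> ?I - {i}"
        have "\<omega> \<notin> cylinder P X t k"
        proof
          assume "\<omega> \<in> cylinder P X t k"
          then have "k = i"
            using k i by (intro PiE_ext[of k "{..t}" "\<lambda>_. UNIV" i]) (auto simp: cylinder_def i_def)
          with k show False
            by simp
        qed
        then show "indicat_real (cylinder P X t k) \<omega> * \<Phi> k = 0"
          by simp
      qed
    qed (use i in auto)
    also have "\<dots> = \<Phi> i"
      using that by (simp add: cylinder_def i_def)
    also have "\<dots> = \<Phi> (\<lambda>s. X s \<omega>)"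
      by (rule depends_uptoD[OF assms(2)]) (simp add: i_def)
    finally show ?thesis ..
  qed
  have int: "integrable P (\<lambda>\<omega>. indicat_real (cylinder P X t i) \<omega> * \<Phi> i)" for i
    using cylinder_sets[OF assms(1), of t i]
    by (intro integrable_mult_left) (simp add: less_top[symmetric])
  have "integrable P (\<lambda>\<omega>. \<Sum>i\<in>?I. indicat_real (cylinder P X t i) \<omega> * \<Phi> i)"
    by (intro Bochner_Integration.integrable_sum int)
  then show "integrable P (\<lambda>\<omega>. \<Phi> (\<lambda>s. X s \<omega>))"
    by (subst Bochner_Integration.integrable_cong[OF refl eq])
  have "integral\<^sup>L P (\<lambda>\<omega>. \<Phi> (\<lambda>s. X s \<omega>)) =
      integral\<^sup>L P (\<lambda>\<omega>. \<Sum>i\<in>?I. indicat_real (cylinder P X t i) \<omega> * \<Phi> i)"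
    by (rule Bochner_Integration.integral_cong[OF refl eq])
  also have "\<dots> = (\<Sum>i\<in>?I. integral\<^sup>L P (\<lambda>\<omega>. indicat_real (cylinder P X t i) \<omega> * \<Phi> i))"
    by (rule Bochner_Integration.integral_sum[OF int])
  also have "\<dots> = (\<Sum>i\<in>?I. prob (cylinder P X t i) * \<Phi> i)"
    using cylinder_sets[OF assms(1)] by (intro sum.cong refl) (simp add: sets.Int_space_eq2)
  finally show "integral\<^sup>L P (\<lambda>\<omega>. \<Phi> (\<lambda>s. X s \<omega>)) =
      (\<Sum>i\<in>?I. prob (cylinder P X t i) * \<Phi> i)" .
qed

text \<open>The hypothesis \<open>zero\<close> says that \<open>D\<close> has mean 0 given the
  states up to \<open>t\<close>; summing over the last coordinate first shows that \<open>D\<close>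
  is orthogonal to functions of the past.\<close>

lemma expectation_martingale_difference:
  fixes X :: "nat \<Rightarrow> 'w \<Rightarrow> 's::finite"
  assumes mc: "markov_chain P X M"
    and G: "depends_upto t G" and D: "depends_upto (Suc t) D"
    and zero: "\<And>x. (\<Sum>j\<in>UNIV. M $ x t $ j * D (x(Suc t := j))) = 0"
  shows "integral\<^sup>L P (\<lambda>\<omega>. G (\<lambda>s. X s \<omega>) * D (\<lambda>s. X s \<omega>)) = 0"
proof -
  let ?p = "\<lambda>t i. measure P (cylinder P X t i)"
  have upd: "?p t (i(Suc t := j)) = ?p t i" "G (i(Suc t := j)) = G i" for i j
    by (simp_all add: cylinder_def, rule depends_uptoD[OF G]) simp
  have "depends_upto (Suc t) (\<lambda>x. G x * D x)"
    using G D by (intro depends_upto_mult) (auto intro: depends_upto_mono)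
  then have "integral\<^sup>L P (\<lambda>\<omega>. G (\<lambda>s. X s \<omega>) * D (\<lambda>s. X s \<omega>)) =
      (\<Sum>i\<in>{..Suc t} \<rightarrow>\<^sub>E UNIV. ?p (Suc t) i * (G i * D i))"
    by (rule expectation_depends_upto[OF mc])
  also have "\<dots> = (\<Sum>i\<in>{..t} \<rightarrow>\<^sub>E UNIV. \<Sum>j\<in>UNIV. ?p t i * G i * (M $ i t $ j * D (i(Suc t := j))))"
    unfolding sum_PiE_Suc by (simp add: cylinder_prob_Suc[OF mc] upd ac_simps)
  also have "\<dots> = 0"
    by (simp add: zero flip: sum_distrib_left)
  finally show ?thesis .
qed

text \<open>From \<open>k\<^sup>2\<close> to any time before the next square there are at most
  \<open>2 * k\<close> steps of size \<open>B\<close>, which is negligible against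
  \<open>k\<^sup>2\<close>.\<close>

lemma squares_average_imp_average:
  fixes s :: "nat \<Rightarrow> real"
  assumes incr: "\<And>n. \<bar>s (Suc n) - s n\<bar> \<le> B"
    and lim: "(\<lambda>k. s (k\<^sup>2) / real (k\<^sup>2)) \<longlonglongrightarrow> 0"
  shows "(\<lambda>n. s n / real n) \<longlonglongrightarrow> 0"
proof -
  have B: "0 \<le> B"
    using incr[of 0] by linarith
  have incr': "\<bar>s (n + d) - s n\<bar> \<le> real d * B" for n d
  proof (induction d)
    case (Suc d)
    then show ?case
      using incr[of "n + d"] by (simp add: algebra_simps)
  qed simp
  have bound: "\<bar>s n / real n\<bar> \<le> \<bar>s ((floor_sqrt n)\<^sup>2) / real ((floor_sqrt n)\<^sup>2)\<bar> + 2 * B / real (floor_sqrt n)"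
    if "n > 0" for n
  proof -
    define k where "k = floor_sqrt n"
    have k: "k > 0" "k\<^sup>2 \<le> n" "n < (Suc k)\<^sup>2"
      using that unfolding k_def by (auto simp: Suc_floor_sqrt_power2_gt)
    then have "n - k\<^sup>2 \<le> 2 * k"
      by (simp add: power2_eq_square)
    then have d: "real (n - k\<^sup>2) \<le> 2 * real k"
      by linarith
    have "\<bar>s n\<bar> \<le> \<bar>s (k\<^sup>2)\<bar> + real (n - k\<^sup>2) * B"
      using incr'[of "k\<^sup>2" "n - k\<^sup>2"] k by simp
    also have "\<dots> \<le> \<bar>s (k\<^sup>2)\<bar> + 2 * real k * B"
      using mult_right_mono[OF d B] by simp
    finally have "\<bar>s n\<bar> / real n \<le> (\<bar>s (k\<^sup>2)\<bar> + 2 * real k * B) / real n"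
      by (simp add: divide_right_mono)
    also have "\<dots> \<le> (\<bar>s (k\<^sup>2)\<bar> + 2 * real k * B) / real (k\<^sup>2)"
      using k B that by (intro divide_left_mono mult_pos_pos) (auto simp del: of_nat_power)
    also have "\<dots> = \<bar>s (k\<^sup>2) / real (k\<^sup>2)\<bar> + 2 * B / real k"
      using k by (simp add: field_simps power2_eq_square)
    finally show ?thesis
      by (simp add: k_def)
  qed
  have sqrt: "filterlim floor_sqrt at_top sequentially"
    unfolding filterlim_at_top
  proof
    fix Z :: nat
    show "\<forall>\<^sub>F n in sequentially. Z \<le> floor_sqrt n"
      using eventually_ge_at_top[of "Z\<^sup>2"]
      by eventually_elim (metis floor_sqrt_inverse_power2 mono_floor_sqrt')
  qed
  have "(\<lambda>k. \<bar>s (k\<^sup>2) / real (k\<^sup>2)\<bar> + 2 * B / real k) \<longlonglongrightarrow> \<bar>0\<bar> + 0"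
    by (intro tendsto_add tendsto_rabs lim lim_const_over_n)
  then have "(\<lambda>k. \<bar>s (k\<^sup>2) / real (k\<^sup>2)\<bar> + 2 * B / real k) \<longlonglongrightarrow> 0"
    by simp
  from filterlim_compose[OF this sqrt]
  have "(\<lambda>n. \<bar>s ((floor_sqrt n)\<^sup>2) / real ((floor_sqrt n)\<^sup>2)\<bar> + 2 * B / real (floor_sqrt n)) \<longlonglongrightarrow> 0" .
  then show ?thesis
    by (rule Lim_null_comparison[rotated])
      (use bound in \<open>auto intro!: eventually_sequentiallyI[of 1]\<close>)
qed

text \<open>Orthogonal increments bound the second moment by \<open>n * B\<^sup>2\<close>. Along
  squares the second moments of the averages are summable, so the sum of the squared averages is
  almost surely finite and they tend to 0; bounded increments fill the gaps.\<close>

lemma martingale_strong_law: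
  fixes X :: "nat \<Rightarrow> 'w \<Rightarrow> 's::finite"
  assumes mc: "markov_chain P X M"
    and D: "\<And>t. depends_upto (Suc t) (D t)"
    and bound: "\<And>t x. \<bar>D t x\<bar> \<le> B"
    and zero: "\<And>t x. (\<Sum>j\<in>UNIV. M $ x t $ j * D t (x(Suc t := j))) = 0"
  shows "AE \<omega> in P. (\<lambda>n. (\<Sum>t<n. D t (\<lambda>s. X s \<omega>)) / real n) \<longlonglongrightarrow> 0"
proof -
  interpret prob_space P
    using mc by (simp add: markov_chain_def)
  define S where "S n x = (\<Sum>t<n. D t x)" for n x
  let ?X = "\<lambda>\<omega> s. X s \<omega>"
  have S: "depends_upto n (S n)" for n
    unfolding S_def
    by (rule depends_upto_sum) (simp add: depends_upto_mono[OF D] Suc_le_eq)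
  have sq: "depends_upto t (\<lambda>x. (\<Phi> x)\<^sup>2)" if "depends_upto t \<Phi>" for t and \<Phi> :: "(nat \<Rightarrow> 's) \<Rightarrow> real"
    using depends_upto_mult[OF that that] by (simp add: power2_eq_square)
  note int = expectation_depends_upto(1)[OF mc]
  have moment: "expectation (\<lambda>\<omega>. (S n (?X \<omega>))\<^sup>2) \<le> real n * B\<^sup>2" for n
  proof (induction n)
    case 0
    then show ?case
      by (simp add: S_def)
  next
    case (Suc n)
    have i1: "integrable P (\<lambda>\<omega>. (S n (?X \<omega>))\<^sup>2)"
      by (rule int[OF sq[OF S]])
    have i2: "integrable P (\<lambda>\<omega>. S n (?X \<omega>) * D n (?X \<omega>))"
      by (rule int[OF depends_upto_mult[OF depends_upto_mono[OF S le_SucI[OF order_refl]] D]])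
    have i3: "integrable P (\<lambda>\<omega>. (D n (?X \<omega>))\<^sup>2)"
      by (rule int[OF sq[OF D]])
    have "expectation (\<lambda>\<omega>. (S (Suc n) (?X \<omega>))\<^sup>2) =
        expectation (\<lambda>\<omega>. (S n (?X \<omega>))\<^sup>2 + 2 * (S n (?X \<omega>) * D n (?X \<omega>)) + (D n (?X \<omega>))\<^sup>2)"
      by (simp add: S_def power2_sum ac_simps)
    also have "\<dots> = expectation (\<lambda>\<omega>. (S n (?X \<omega>))\<^sup>2) +
        2 * expectation (\<lambda>\<omega>. S n (?X \<omega>) * D n (?X \<omega>)) + expectation (\<lambda>\<omega>. (D n (?X \<omega>))\<^sup>2)"
      using i1 i2 i3 by simp
    also have "expectation (\<lambda>\<omega>. S n (?X \<omega>) * D n (?X \<omega>)) = 0"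
      by (rule expectation_martingale_difference[OF mc S D zero])
    also have "expectation (\<lambda>\<omega>. (D n (?X \<omega>))\<^sup>2) \<le> expectation (\<lambda>\<omega>. B\<^sup>2)"
    proof (rule integral_mono[OF i3])
      show "(D n (?X \<omega>))\<^sup>2 \<le> B\<^sup>2" for \<omega>
        using power_mono[OF bound[of n "?X \<omega>"], of 2] by simp
    qed simp
    finally show ?case
      using Suc by (simp add: prob_space algebra_simps)
  qed
  define f where "f k \<omega> = (S (k\<^sup>2) (?X \<omega>) / real (k\<^sup>2))\<^sup>2" for k \<omega>
  have f_int: "integrable P (f k)" for k
    unfolding f_def power_divide by (intro integrable_divide_zero impI int[OF sq[OF S]])
  have [measurable]: "f k \<in> borel_measurable P" for k
    using f_int by simp
  have f_nonneg: "0 \<le> f k \<omega>" for k \<omega>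
    by (simp add: f_def)
  have f_exp: "expectation (f k) \<le> B\<^sup>2 * inverse (real k ^ 2)" for k
  proof -
    have "expectation (f k) = expectation (\<lambda>\<omega>. (S (k\<^sup>2) (?X \<omega>))\<^sup>2) / (real (k\<^sup>2))\<^sup>2"
      unfolding f_def power_divide by simp
    also have "\<dots> \<le> real (k\<^sup>2) * B\<^sup>2 / (real (k\<^sup>2))\<^sup>2"
      by (intro divide_right_mono moment) simp
    also have "\<dots> = B\<^sup>2 * inverse (real k ^ 2)"
      \<comment> \<open>At \<open>k = 0\<close> both sides are 0, by the value of division by
        0.\<close>
      by (cases "k = 0") (simp_all add: field_simps power2_eq_square)
    finally show ?thesis .
  qed
  have summ: "summable (\<lambda>k. B\<^sup>2 * inverse (real k ^ 2))"
    by (intro summable_mult inverse_power_summable) simp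
  have "(\<integral>\<^sup>+ \<omega>. (\<Sum>k. ennreal (f k \<omega>)) \<partial>P) = (\<Sum>k. \<integral>\<^sup>+ \<omega>. ennreal (f k \<omega>) \<partial>P)"
    by (rule nn_integral_suminf) measurable
  also have "\<dots> = (\<Sum>k. ennreal (expectation (f k)))"
    by (intro suminf_cong nn_integral_eq_integral f_int) (simp add: f_nonneg)
  also have "\<dots> \<le> (\<Sum>k. ennreal (B\<^sup>2 * inverse (real k ^ 2)))"
    by (intro suminf_le ennreal_leI f_exp) auto
  also have "\<dots> = ennreal (\<Sum>k. B\<^sup>2 * inverse (real k ^ 2))"
    by (rule suminf_ennreal2[OF _ summ]) simp
  also have "\<dots> < top"
    by simp
  finally have "(\<integral>\<^sup>+ \<omega>. (\<Sum>k. ennreal (f k \<omega>)) \<partial>P) \<noteq> \<infinity>"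
    by simp
  then have "AE \<omega> in P. (\<Sum>k. ennreal (f k \<omega>)) \<noteq> \<infinity>"
    by (intro nn_integral_noteq_infinite) auto
  then show ?thesis
  proof eventually_elim
    case (elim \<omega>)
    then have "summable (\<lambda>k. f k \<omega>)"
      by (intro summable_suminf_not_top f_nonneg) simp
    then have "(\<lambda>k. (S (k\<^sup>2) (?X \<omega>) / real (k\<^sup>2))\<^sup>2) \<longlonglongrightarrow> 0"
      unfolding f_def by (rule summable_LIMSEQ_zero)
    from tendsto_real_sqrt[OF this]
    have "(\<lambda>k. \<bar>S (k\<^sup>2) (?X \<omega>) / real (k\<^sup>2)\<bar>) \<longlonglongrightarrow> 0"
      by simp
    then have "(\<lambda>k. S (k\<^sup>2) (?X \<omega>) / real (k\<^sup>2)) \<longlonglongrightarrow> 0"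
      by (rule tendsto_rabs_zero_cancel)
    then have "(\<lambda>n. S n (?X \<omega>) / real n) \<longlonglongrightarrow> 0"
      by (rule squares_average_imp_average[where B = B, rotated]) (simp add: S_def bound)
    then show ?case
      by (simp add: S_def)
  qed
qed

section \<open>Cycle weights\<close>

text \<open>A finite type of states of the derived chain, to which \<open>poisson_equation\<close> applies.\<close>

typedef 's simple_path = "simple_lists :: 's list set"
proof
  show "[undefined] \<in> (simple_lists :: 's list set)"
    by (simp add: simple_lists_def)
qed

instance simple_path :: (finite) finite
proof
  have "UNIV = Abs_simple_path ` (simple_lists :: 'a list set)"
    using type_definition.Abs_image[OF type_definition_simple_path] by auto
  then show "finite (UNIV :: 'a simple_path set)"
    by (metis finite_imageI finite_simple_lists)
qed

section \<open>The Poisson equation for the derived chain\<close>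

context stochastic_kernel begin

lemma ex_pos: "\<exists>j. 0 < m i j"
proof (rule ccontr)
  assume "\<nexists>j. 0 < m i j"
  then have "m i j = 0" for j
    using nonneg[of i j] by (metis less_eq_real_def)
  then show False
    using row_sum[of i] by simp
qed

text \<open>Moves are labelled by the next position \<open>j\<close>, and several labels may lead to
  the same state, so the kernel collects their probabilities.\<close>

lemma poisson_equation_step:
  fixes next_state :: "'x::finite \<Rightarrow> 's \<Rightarrow> 'x"
  assumes reach: "\<And>x. (x, x0) \<in> {(x, next_state x j) | x j. 0 < m (pos x) j}\<^sup>*"
  obtains g \<kappa> where "\<And>x. g x + \<kappa> = f x + (\<Sum>j\<in>UNIV. m (pos x) j * g (next_state x j))"
proof -
  define K where "K x y = (\<Sum>j\<in>UNIV. m (pos x) j * of_bool (y = next_state x j))" for x y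
  have K_sum: "(\<Sum>y\<in>UNIV. K x y * h y) = (\<Sum>j\<in>UNIV. m (pos x) j * h (next_state x j))" for x and h :: "'x \<Rightarrow> real"
  proof -
    have "(\<Sum>y\<in>UNIV. K x y * h y) =
        (\<Sum>j\<in>UNIV. \<Sum>y\<in>UNIV. m (pos x) j * (of_bool (y = next_state x j) * h y))"
      unfolding K_def sum_distrib_right by (subst sum.swap) (simp add: mult.assoc)
    also have "\<dots> = (\<Sum>j\<in>UNIV. m (pos x) j * h (next_state x j))"
      by (simp add: of_bool_def if_distrib[of "\<lambda>z. z * _"] cong: if_cong flip: sum_distrib_left)
    finally show ?thesis .
  qed
  have K_ge: "m (pos x) j \<le> K x (next_state x j)" for x j
  proof -
    have "m (pos x) j * of_bool (next_state x j = next_state x j) \<le> K x (next_state x j)"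
      unfolding K_def by (rule member_le_sum) (auto simp: nonneg)
    then show ?thesis
      by simp
  qed
  have edges: "{(x, next_state x j) | x j. 0 < m (pos x) j} \<subseteq> {(x, y). 0 < K x y}"
    using K_ge less_le_trans by fastforce
  obtain g \<kappa> where "\<And>x. g x + \<kappa> = f x + (\<Sum>y\<in>UNIV. K x y * g y)"
  proof (rule poisson_equation[of K x0 f])
    show "0 \<le> K x y" for x y
      unfolding K_def by (intro sum_nonneg) (simp add: nonneg)
    show "(\<Sum>y\<in>UNIV. K x y) = 1" for x
      using K_sum[of x "\<lambda>_. 1"] by (simp add: row_sum)
    show "(x, x0) \<in> {(x, y). 0 < K x y}\<^sup>*" for x
      using reach[of x] rtrancl_mono[OF edges] by blast
  qed blast
  then show ?thesis
    using that[of g \<kappa>] by (simp add: K_sum)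
qed

text \<open>The Poisson equation for the formation indicator has some constant \<kappa>; summing it
  against the invariant \<open>path_mass\<close> cancels the corrector and evaluates \<kappa>. The
  state \<open>[a]\<close> serves as reference, since every return to \<open>a\<close> resets the
  derived chain to it.\<close>

lemma derived_chain_poisson_from:
  assumes irred: "\<And>i j. (i, j) \<in> {(i, j). 0 < m i j}\<^sup>*"
    and c: "c \<in> all_cycles"
  shows "\<exists>g. \<forall>\<eta>\<in>simple_lists_from a. g \<eta> + cycle_mass c / forest_total =
    (\<Sum>j\<in>UNIV. m (last \<eta>) j * (of_bool (forms c \<eta> j) + g (next_path \<eta> j)))"
proof -
  let ?R = "Rep_simple_path" and ?A = "Abs_simple_path"
  define pos where "pos x = last (?R x)" for x :: "'s simple_path"
  \<comment> \<open>Paths not starting at \<open>a\<close> are sent to \<open>[a]\<close>, which is then reachable from everywhere.\<close>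
  define N where "N x j = (if hd (?R x) = a then ?A (next_path (?R x) j) else ?A [a])" for x j
  define f where "f x = (\<Sum>j\<in>UNIV. m (pos x) j * of_bool (forms c (?R x) j))" for x
  let ?E = "{(x, N x j) | x j. 0 < m (pos x) j}"
  have R: "?R x \<in> simple_lists" for x :: "'s simple_path"
    by (rule Rep_simple_path)
  have RA: "?R (?A \<eta>) = \<eta>" if "\<eta> \<in> simple_lists" for \<eta> :: "'s list"
    using that by (rule Abs_simple_path_inverse)
  have R_N: "?R (N x j) = next_path (?R x) j" if "hd (?R x) = a" for x j
    unfolding N_def using that by (simp add: RA[OF next_path_simple[OF R]])
  have reach: "(x, ?A [a]) \<in> ?E\<^sup>*" for x
  proof (cases "hd (?R x) = a")
    case False
    obtain j where "0 < m (pos x) j"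
      using ex_pos by blast
    then have "(x, N x j) \<in> ?E"
      by auto
    then show ?thesis
      using False by (auto simp: N_def)
  next
    case True
    \<comment> \<open>A path of the original chain lifts to the derived chain, whose last entry
      tracks the position.\<close>
    have "\<exists>y. (x, y) \<in> ?E\<^sup>* \<and> hd (?R y) = a \<and> pos y = i" if "(pos x, i) \<in> {(i, j). 0 < m i j}\<^sup>*" for i
      using that
    proof (induction rule: rtrancl_induct)
      case base
      then show ?case
        using True by blast
    next
      case (step i j)
      then obtain y where y: "(x, y) \<in> ?E\<^sup>*" "hd (?R y) = a" "pos y = i"
        by blast
      then have "(y, N y j) \<in> ?E"
        using step.hyps(2) by auto
      with y(1) have "(x, N y j) \<in> ?E\<^sup>*"
        by (rule rtrancl_into_rtrancl)
      moreover have "?R y \<noteq> []"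
        using R[of y] by (simp add: simple_lists_def)
      then have "hd (?R (N y j)) = a"
        unfolding R_N[OF y(2)] by (subst hd_next_path) (simp_all add: y(2))
      moreover have "pos (N y j) = j"
        unfolding pos_def by (simp only: R_N[OF y(2)] last_snoc)
      ultimately show ?case
        by blast
    qed
    from this[OF irred[of "pos x" a]]
    obtain y where y: "(x, y) \<in> ?E\<^sup>*" "hd (?R y) = a" "last (?R y) = a"
      by (auto simp: pos_def)
    have "\<eta> = [a]" if "\<eta> \<in> simple_lists" "hd \<eta> = a" "last \<eta> = a" for \<eta>
      using that by (cases \<eta> rule: list.exhaust) (auto simp: simple_lists_def split: if_splits)
    then have "?R y = [a]"
      using R y(2,3) by blast
    then have "y = ?A [a]"
      by (metis Rep_simple_path_inverse)
    with y(1) show ?thesis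
      by simp
  qed
  obtain g \<kappa> where g: "\<And>x. g x + \<kappa> = f x + (\<Sum>j\<in>UNIV. m (pos x) j * g (N x j))"
    using poisson_equation_step[where pos = pos and next_state = N, OF reach] by blast
  define G where "G \<eta> = g (?A \<eta>)" for \<eta>
  have G: "G \<eta> + \<kappa> = (\<Sum>j\<in>UNIV. m (last \<eta>) j * (of_bool (forms c \<eta> j) + G (next_path \<eta> j)))"
    if "\<eta> \<in> simple_lists_from a" for \<eta>
  proof -
    have "?R (?A \<eta>) = \<eta>" "hd \<eta> = a"
      using that RA by (auto simp: simple_lists_from_def)
    then show ?thesis
      using g[of "?A \<eta>"] by (simp add: G_def f_def pos_def N_def distrib_left sum.distrib)
  qed
  let ?L = "simple_lists_from a"
  have "(\<Sum>\<eta>\<in>?L. path_mass \<eta> * (G \<eta> + \<kappa>)) =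
      (\<Sum>\<eta>\<in>?L. \<Sum>j\<in>UNIV. path_mass \<eta> * m (last \<eta>) j * of_bool (forms c \<eta> j)) +
      (\<Sum>\<eta>\<in>?L. \<Sum>j\<in>UNIV. path_mass \<eta> * m (last \<eta>) j * G (next_path \<eta> j))"
    unfolding sum.distrib[symmetric]
  proof (rule sum.cong[OF refl])
    fix \<eta> assume "\<eta> \<in> ?L"
    from G[OF this] show "path_mass \<eta> * (G \<eta> + \<kappa>) =
        (\<Sum>j\<in>UNIV. path_mass \<eta> * m (last \<eta>) j * of_bool (forms c \<eta> j) +
          path_mass \<eta> * m (last \<eta>) j * G (next_path \<eta> j))"
      by (simp only: sum_distrib_left distrib_left mult.assoc)
  qed
  also have "\<dots> = cycle_mass c + (\<Sum>\<eta>\<in>?L. path_mass \<eta> * G \<eta>)"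
    using c path_mass_forms[of _ a] unfolding path_mass_stationary by (auto simp: all_cycles_def)
  finally have "\<kappa> * forest_total = cycle_mass c"
    by (simp add: distrib_left sum.distrib sum_path_mass mult.commute[of _ \<kappa>] flip: sum_distrib_left)
  moreover have "0 < forest_total"
    using irred by (rule forest_total_pos)
  ultimately have "\<kappa> = cycle_mass c / forest_total"
    by (simp add: field_simps)
  then show ?thesis
    using G by auto
qed

text \<open>The head of the derived chain never changes, so solutions for the separate starting
  states are glued along \<open>hd\<close>. The constant is common to all of them.\<close>

lemma derived_chain_poisson:
  assumes "\<And>i j. (i, j) \<in> {(i, j). 0 < m i j}\<^sup>*" "c \<in> all_cycles"
  obtains g where "\<And>\<eta>. \<eta> \<in> simple_lists \<Longrightarrow> g \<eta> + cycle_mass c / forest_total =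
    (\<Sum>j\<in>UNIV. m (last \<eta>) j * (of_bool (forms c \<eta> j) + g (next_path \<eta> j)))"
proof -
  have "\<exists>G. \<forall>a. \<forall>\<eta>\<in>simple_lists_from a. G a \<eta> + cycle_mass c / forest_total =
      (\<Sum>j\<in>UNIV. m (last \<eta>) j * (of_bool (forms c \<eta> j) + G a (next_path \<eta> j)))"
    by (intro choice allI derived_chain_poisson_from assms)
  then obtain G where G: "\<And>a \<eta>. \<eta> \<in> simple_lists_from a \<Longrightarrow> G a \<eta> + cycle_mass c / forest_total =
      (\<Sum>j\<in>UNIV. m (last \<eta>) j * (of_bool (forms c \<eta> j) + G a (next_path \<eta> j)))"
    by blast
  show ?thesis
  proof (rule that[of "\<lambda>\<eta>. G (hd \<eta>) \<eta>"])
    fix \<eta> :: "'s list" assume \<eta>: "\<eta> \<in> simple_lists"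
    then have "hd (next_path \<eta> j) = hd \<eta>" for j
      by (intro hd_next_path) (simp add: simple_lists_def)
    moreover have "\<eta> \<in> simple_lists_from (hd \<eta>)"
      using \<eta> by (simp add: simple_lists_from_def)
    ultimately show "G (hd \<eta>) \<eta> + cycle_mass c / forest_total =
        (\<Sum>j\<in>UNIV. m (last \<eta>) j * (of_bool (forms c \<eta> j) + G (hd (next_path \<eta> j)) (next_path \<eta> j)))"
      using G by simp
  qed
qed

end

section \<open>Almost sure frequencies of cycle formation\<close>

lemma derived_chain_Suc: "derived_chain x (Suc t) = next_path (derived_chain x t) (x (Suc t))"
  \<comment> \<open>If the new state is absent, \<open>takeWhile\<close> keeps the whole list, so
    one formula covers both cases of the definition.\<close>
  by (simp add: takeWhile_not_in)

lemma derived_chain_simple: "derived_chain x t \<in> simple_lists"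
proof (induction t)
  case (Suc t)
  then show ?case
    unfolding derived_chain_Suc by (rule next_path_simple)
qed (simp add: simple_lists_def)

lemma last_derived_chain: "last (derived_chain x t) = x t"
  by (cases t) auto

lemma derived_chain_cong: "(\<And>s. s \<le> t \<Longrightarrow> x s = y s) \<Longrightarrow> derived_chain x t = derived_chain y t"
proof (induction t)
  case (Suc t)
  then have "derived_chain x t = derived_chain y t" "x (Suc t) = y (Suc t)"
    by simp_all
  then show ?case
    unfolding derived_chain_Suc by simp
qed simp

lemma formation_count_eq:
  "real (formation_count x c n) = (\<Sum>t<n. of_bool (forms c (derived_chain x t) (x (Suc t))))"
proof (induction n)
  case 0
  then show ?case
    by (simp add: formation_count_def)
next
  case (Suc n)
  let ?S = "\<lambda>n. {s \<in> {1..n}. formed_at x c s}"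
  have "formed_at x c (Suc n) \<longleftrightarrow> forms c (derived_chain x n) (x (Suc n))"
    by (simp add: formed_at_def)
  moreover have "?S (Suc n) = (if formed_at x c (Suc n) then insert (Suc n) (?S n) else ?S n)"
    by (auto simp: le_Suc_eq)
  ultimately have "formation_count x c (Suc n) =
      formation_count x c n + of_bool (forms c (derived_chain x n) (x (Suc n)))"
    unfolding formation_count_def by simp
  with Suc show ?case
    by simp
qed

text \<open>The Poisson solution \<open>g\<close> corrects each centered count increment to a
  martingale difference \<open>D\<close>; the corrections telescope and stay bounded, so by the
  strong law the averaged counts tend to \<kappa>.\<close>

lemma cycle_weight_eq:
  fixes X :: "nat \<Rightarrow> 'w \<Rightarrow> 's::finite"
  assumes mc: "markov_chain P X M"
    and irred: "\<And>i j. (i, j) \<in> {(i, j). 0 < M $ i $ j}\<^sup>*"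
    and c: "c \<in> all_cycles"
    and kernel: "stochastic_kernel (\<lambda>i j. M $ i $ j)"
  shows "cycle_weight P X c = stochastic_kernel.cycle_mass (\<lambda>i j. M $ i $ j) c /
    stochastic_kernel.forest_total (\<lambda>i j. M $ i $ j)"
proof -
  interpret stochastic_kernel "\<lambda>i j. M $ i $ j"
    by (rule kernel)
  interpret P: prob_space P
    using mc by (simp add: markov_chain_def)
  define \<kappa> where "\<kappa> = cycle_mass c / forest_total"
  obtain g where g: "\<And>\<eta>. \<eta> \<in> simple_lists \<Longrightarrow> g \<eta> + \<kappa> =
      (\<Sum>j\<in>UNIV. M $ last \<eta> $ j * (of_bool (forms c \<eta> j) + g (next_path \<eta> j)))"
    unfolding \<kappa>_def using derived_chain_poisson[OF irred c] by blast
  let ?\<eta> = "derived_chain"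
  define D where "D t x = of_bool (forms c (?\<eta> x t) (x (Suc t))) - \<kappa> + g (?\<eta> x (Suc t)) - g (?\<eta> x t)" for t x
  define C where "C = (\<Sum>\<eta>\<in>simple_lists. \<bar>g \<eta>\<bar>)"
  have C: "\<bar>g (?\<eta> x t)\<bar> \<le> C" for x t
    unfolding C_def using derived_chain_simple by (intro member_le_sum) (auto simp: finite_simple_lists)
  have sum_D: "(\<Sum>t<n. D t x) = real (formation_count x c n) - real n * \<kappa> + g (?\<eta> x n) - g (?\<eta> x 0)" for n x
    unfolding formation_count_eq by (induction n) (simp_all add: D_def algebra_simps del: derived_chain.simps)
  have "AE \<omega> in P. (\<lambda>n. (\<Sum>t<n. D t (\<lambda>s. X s \<omega>)) / real n) \<longlonglongrightarrow> 0"
  proof (rule martingale_strong_law[OF mc])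
    show "depends_upto (Suc t) (D t)" for t
      unfolding depends_upto_def
    proof (intro allI impI)
      fix x y :: "nat \<Rightarrow> 's" assume eq: "\<forall>s\<le>Suc t. x s = y s"
      then have "?\<eta> x t = ?\<eta> y t" "?\<eta> x (Suc t) = ?\<eta> y (Suc t)" "x (Suc t) = y (Suc t)"
        by (auto intro!: derived_chain_cong simp del: derived_chain.simps)
      then show "D t x = D t y"
        unfolding D_def by simp
    qed
    show "\<bar>D t x\<bar> \<le> 1 + \<bar>\<kappa>\<bar> + 2 * C" for t x
    proof -
      have "\<bar>of_bool (forms c (?\<eta> x t) (x (Suc t)))\<bar> \<le> (1 :: real)"
        by simp
      then show ?thesis
        unfolding D_def using C[of x t] C[of x "Suc t"] by linarith
    qed
    show "(\<Sum>j\<in>UNIV. M $ x t $ j * D t (x(Suc t := j))) = 0" for t x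
    proof -
      define \<eta> where "\<eta> = ?\<eta> x t"
      have \<eta>: "?\<eta> (x(Suc t := j)) t = \<eta>" for j
        unfolding \<eta>_def by (rule derived_chain_cong) simp
      have "D t (x(Suc t := j)) = (of_bool (forms c \<eta> j) + g (next_path \<eta> j)) - (\<kappa> + g \<eta>)" for j
        unfolding D_def derived_chain_Suc \<eta> by simp
      then have "(\<Sum>j\<in>UNIV. M $ x t $ j * D t (x(Suc t := j))) =
          (\<Sum>j\<in>UNIV. M $ x t $ j * (of_bool (forms c \<eta> j) + g (next_path \<eta> j))) -
          (\<Sum>j\<in>UNIV. M $ x t $ j) * (\<kappa> + g \<eta>)"
        by (simp only: right_diff_distrib sum_subtractf sum_distrib_right)
      also have "\<dots> = 0"
        using g[of \<eta>] last_derived_chain[of x t] by (simp add: row_sum \<eta>_def derived_chain_simple)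
      finally show ?thesis .
    qed
  qed
  then have lim: "AE \<omega> in P. (\<lambda>n. real (formation_count (\<lambda>s. X s \<omega>) c n) / real n) \<longlonglongrightarrow> \<kappa>"
  proof eventually_elim
    case (elim \<omega>)
    let ?x = "\<lambda>s. X s \<omega>"
    have "(\<lambda>n. (g (?\<eta> ?x n) - g (?\<eta> ?x 0)) / real n) \<longlonglongrightarrow> 0"
    proof (rule Lim_null_comparison)
      show "\<forall>\<^sub>F n in sequentially. norm ((g (?\<eta> ?x n) - g (?\<eta> ?x 0)) / real n) \<le> (2 * C) / real n"
      proof (intro always_eventually allI)
        fix n
        have "\<bar>g (?\<eta> ?x n) - g (?\<eta> ?x 0)\<bar> \<le> 2 * C"
          using C[of ?x n] C[of ?x 0] by linarith
        then show "norm ((g (?\<eta> ?x n) - g (?\<eta> ?x 0)) / real n) \<le> (2 * C) / real n"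
          by (simp add: divide_right_mono del: derived_chain.simps)
      qed
    qed (rule lim_const_over_n)
    with elim have "(\<lambda>n. (\<Sum>t<n. D t ?x) / real n + \<kappa> - (g (?\<eta> ?x n) - g (?\<eta> ?x 0)) / real n) \<longlonglongrightarrow> 0 + \<kappa> - 0"
      by (intro tendsto_intros)
    moreover have "\<forall>\<^sub>F n in sequentially. (\<Sum>t<n. D t ?x) / real n + \<kappa> - (g (?\<eta> ?x n) - g (?\<eta> ?x 0)) / real n =
        real (formation_count ?x c n) / real n"
      using eventually_gt_at_top[of 0]
      by eventually_elim (simp add: sum_D field_simps del: derived_chain.simps)
    ultimately show ?case
      using tendsto_cong by force
  qed
  show ?thesis
    unfolding cycle_weight_def \<kappa>_def[symmetric]
  proof (rule the_equality)
    show "AE \<omega> in P. (\<lambda>t. real (formation_count (\<lambda>s. X s \<omega>) c t) / real t) \<longlonglongrightarrow> \<kappa>"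
      by (rule lim)
  next
    fix w assume "AE \<omega> in P. (\<lambda>t. real (formation_count (\<lambda>s. X s \<omega>) c t) / real t) \<longlonglongrightarrow> w"
    with lim have "AE \<omega> in P. w = \<kappa>"
      by eventually_elim (rule LIMSEQ_unique)
    \<comment> \<open>On a probability space an almost sure equation between constants holds
      outright.\<close>
    then show "w = \<kappa>"
      by simp
  qed
qed

section \<open>Entropy production\<close>

lemma matrix_pow_pos_imp_path:
  assumes nonneg: "\<And>i j. 0 \<le> M $ i $ j"
  shows "0 < matrix_pow M k $ i $ j \<Longrightarrow> (i, j) \<in> {(i, j). 0 < M $ i $ j}\<^sup>*"
proof (induction k arbitrary: j)
  case 0
  then have "i = j"
    by (simp add: matrix_pow_def mat_def split: if_splits)
  then show ?case
    by simp
next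
  case (Suc k)
  then have "0 < (\<Sum>l\<in>UNIV. matrix_pow M k $ i $ l * M $ l $ j)"
    by (simp add: matrix_pow_def matrix_matrix_mult_def)
  then obtain l where "0 < matrix_pow M k $ i $ l * M $ l $ j"
    by (meson not_less sum_nonpos)
  then have "0 < matrix_pow M k $ i $ l" "0 < M $ l $ j"
    using nonneg[of l j] by (auto simp: zero_less_mult_iff)
  with Suc.IH[of l] show ?case
    by (auto intro: rtrancl_into_rtrancl)
qed

lemma sum_PiE_0: "(\<Sum>i\<in>{..0::nat} \<rightarrow>\<^sub>E (UNIV :: 's::finite set). f (i 0)) = (\<Sum>j\<in>UNIV. (f j :: real))"
proof (rule sum.reindex_bij_witness[where i = "\<lambda>j. \<lambda>s. if s = 0 then j else undefined" and j = "\<lambda>i. i 0"])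
  fix i :: "nat \<Rightarrow> 's" assume "i \<in> {..0} \<rightarrow>\<^sub>E UNIV"
  then show "(\<lambda>s. if s = 0 then i 0 else undefined) = i"
    by (auto simp: fun_eq_iff PiE_def extensional_def)
qed (auto simp: PiE_def extensional_def)

text \<open>Adding \<open>h\<close> at the endpoint makes the expected log ratio grow by exactly
  \<kappa> per step. The initial law and \<open>h\<close> contribute bounded boundary terms, which
  vanish after division by \<open>t\<close>.\<close>

lemma entropy_production_rate_eq:
  fixes M :: "real ^ 's ^ 's::finite"
  assumes "stochastic_matrix M" "probability_vector p0" "\<And>i. 0 < p0 $ i"
    and sym: "\<And>i j. 0 < M $ i $ j \<longleftrightarrow> 0 < M $ j $ i"
    and h: "\<And>i. h i + \<kappa> = (\<Sum>j\<in>UNIV. M $ i $ j * (ln (M $ i $ j / M $ j $ i) + h j))"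
  shows "entropy_production_rate M p0 = \<kappa>"
proof -
  define \<phi> where "\<phi> i j = ln (M $ i $ j / M $ j $ i)" for i j
  define W where "W t i = p0 $ i 0 * (\<Prod>k<t. M $ i k $ i (Suc k))" for t i
  let ?I = "\<lambda>t. {..t} \<rightarrow>\<^sub>E (UNIV :: 's set)"
  have M: "0 \<le> M $ i $ j" "(\<Sum>j\<in>UNIV. M $ i $ j) = 1" for i j
    using assms(1) by (auto simp: stochastic_matrix_def probability_vector_def)
  have W_nonneg: "0 \<le> W t i" for t i
    unfolding W_def using assms(3)[of "i 0"] by (intro mult_nonneg_nonneg prod_nonneg) (auto simp: M)
  have W_Suc: "W (Suc t) (i(Suc t := j)) = W t i * M $ i t $ j" for t i j
  proof -
    have "(\<Prod>k<t. M $ (i(Suc t := j)) k $ (i(Suc t := j)) (Suc k)) = (\<Prod>k<t. M $ i k $ i (Suc k))"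
      by (intro prod.cong) auto
    then show ?thesis
      unfolding W_def by (simp add: mult.assoc)
  qed
  have sum_W: "(\<Sum>i\<in>?I t. W t i) = 1" for t
  proof (induction t)
    case 0
    have "(\<Sum>i\<in>?I 0. W 0 i) = (\<Sum>j\<in>UNIV. p0 $ j)"
      unfolding W_def using sum_PiE_0[of "\<lambda>j. p0 $ j"] by simp
    then show ?case
      using assms(2) by (simp add: probability_vector_def)
  next
    case (Suc t)
    then show ?case
      by (simp add: sum_PiE_Suc W_Suc M flip: sum_distrib_left)
  qed
  have main: "(\<Sum>i\<in>?I t. W t i * ((\<Sum>k<t. \<phi> (i k) (i (Suc k))) + h (i t))) =
      real t * \<kappa> + (\<Sum>j\<in>UNIV. p0 $ j * h j)" for t
  proof (induction t)
    case 0
    then show ?case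
      unfolding W_def using sum_PiE_0[of "\<lambda>j. p0 $ j * h j"] by simp
  next
    case (Suc t)
    have "(\<Sum>j\<in>UNIV. W (Suc t) (i(Suc t := j)) *
        ((\<Sum>k<Suc t. \<phi> ((i(Suc t := j)) k) ((i(Suc t := j)) (Suc k))) + h ((i(Suc t := j)) (Suc t)))) =
      W t i * ((\<Sum>k<t. \<phi> (i k) (i (Suc k))) + h (i t)) + \<kappa> * W t i" for i
    proof -
      define S where "S = (\<Sum>k<t. \<phi> (i k) (i (Suc k)))"
      have "(\<Sum>k<t. \<phi> ((i(Suc t := j)) k) ((i(Suc t := j)) (Suc k))) = S" for j
        unfolding S_def by (intro sum.cong) auto
      then have "(\<Sum>j\<in>UNIV. W (Suc t) (i(Suc t := j)) *
          ((\<Sum>k<Suc t. \<phi> ((i(Suc t := j)) k) ((i(Suc t := j)) (Suc k))) + h ((i(Suc t := j)) (Suc t)))) =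
        (\<Sum>j\<in>UNIV. W t i * (M $ i t $ j * S + M $ i t $ j * (\<phi> (i t) j + h j)))"
        unfolding W_Suc by (simp add: algebra_simps)
      also have "\<dots> = W t i * ((\<Sum>j\<in>UNIV. M $ i t $ j) * S + (\<Sum>j\<in>UNIV. M $ i t $ j * (\<phi> (i t) j + h j)))"
        by (simp only: sum_distrib_left sum_distrib_right sum.distrib distrib_left)
      also have "\<dots> = W t i * (S + (h (i t) + \<kappa>))"
        by (simp add: M h \<phi>_def)
      finally show ?thesis
        by (simp add: algebra_simps S_def)
    qed
    then have "(\<Sum>i\<in>?I (Suc t). W (Suc t) i * ((\<Sum>k<Suc t. \<phi> (i k) (i (Suc k))) + h (i (Suc t)))) =
        (\<Sum>i\<in>?I t. W t i * ((\<Sum>k<t. \<phi> (i k) (i (Suc k))) + h (i t)) + \<kappa> * W t i)"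
      unfolding sum_PiE_Suc by simp
    also have "\<dots> = real (Suc t) * \<kappa> + (\<Sum>j\<in>UNIV. p0 $ j * h j)"
      by (simp only: sum.distrib Suc sum_W flip: sum_distrib_left) (simp add: algebra_simps)
    finally show ?case .
  qed
  \<comment> \<open>On a path of positive weight, \<open>sym\<close> makes every reversed factor
    positive and the logarithm splits; on other paths the leading factor \<open>W t i\<close> is
    0.\<close>
  have summand: "W t i * ln (W t i / (p0 $ i t * (\<Prod>k<t. M $ i (Suc k) $ i k))) =
      W t i * (ln (p0 $ i 0) - ln (p0 $ i t) + (\<Sum>k<t. \<phi> (i k) (i (Suc k))))" for t i
  proof (cases "W t i = 0")
    case False
    then have "M $ i k $ i (Suc k) \<noteq> 0" if "k < t" for k
      using that by (auto simp: W_def)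
    then have pos: "0 < M $ i k $ i (Suc k)" "0 < M $ i (Suc k) $ i k" if "k < t" for k
      using that sym M(1) by (metis less_eq_real_def)+
    have "ln (W t i / (p0 $ i t * (\<Prod>k<t. M $ i (Suc k) $ i k))) =
        ln (p0 $ i 0 / p0 $ i t * (\<Prod>k<t. M $ i k $ i (Suc k) / M $ i (Suc k) $ i k))"
      by (simp add: W_def prod_dividef)
    also have "\<dots> = ln (p0 $ i 0 / p0 $ i t) + ln (\<Prod>k<t. M $ i k $ i (Suc k) / M $ i (Suc k) $ i k)"
      by (rule ln_mult_pos) (auto intro!: prod_pos divide_pos_pos simp: pos assms(3))
    also have "ln (\<Prod>k<t. M $ i k $ i (Suc k) / M $ i (Suc k) $ i k) = (\<Sum>k<t. \<phi> (i k) (i (Suc k)))"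
      unfolding \<phi>_def
    proof (rule ln_prod)
      fix k assume "k \<in> {..<t}"
      then show "M $ i k $ i (Suc k) / M $ i (Suc k) $ i k \<noteq> 0"
        using pos[of k] by simp
    qed simp
    also have "ln (p0 $ i 0 / p0 $ i t) = ln (p0 $ i 0) - ln (p0 $ i t)"
      using assms(3)[of "i 0"] assms(3)[of "i t"] by (simp add: ln_div)
    finally show ?thesis
      by simp
  qed simp
  define C where "C = 2 * (\<Sum>j\<in>UNIV. \<bar>ln (p0 $ j)\<bar>) + (\<Sum>j\<in>UNIV. \<bar>h j\<bar>)"
  have C: "\<bar>ln (p0 $ a) - ln (p0 $ b) - h b\<bar> \<le> C" for a b
  proof -
    have "\<bar>ln (p0 $ c)\<bar> \<le> (\<Sum>j\<in>UNIV. \<bar>ln (p0 $ j)\<bar>)" "\<bar>h c\<bar> \<le> (\<Sum>j\<in>UNIV. \<bar>h j\<bar>)" for c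
      by (rule member_le_sum; simp)+
    from this(1)[of a] this(1)[of b] this(2)[of b] show ?thesis
      unfolding C_def by linarith
  qed
  \<comment> \<open>The boundary terms; the endpoint value of \<open>h\<close> that was added in
    \<open>main\<close> is subtracted here.\<close>
  define r where "r t = (\<Sum>i\<in>?I t. W t i * (ln (p0 $ i 0) - ln (p0 $ i t) - h (i t)))" for t
  have r: "\<bar>r t\<bar> \<le> C" for t
  proof -
    have "\<bar>r t\<bar> \<le> (\<Sum>i\<in>?I t. W t i * C)"
      unfolding r_def by (rule order_trans[OF sum_abs], rule sum_mono)
        (auto simp: abs_mult W_nonneg C intro!: mult_left_mono)
    also have "\<dots> = C"
      by (simp add: sum_W flip: sum_distrib_right)
    finally show ?thesis .
  qed
  define K where "K = (\<Sum>j\<in>UNIV. p0 $ j * h j)"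
  have H: "path_relative_entropy M p0 t = real t * \<kappa> + K + r t" for t
  proof -
    have "path_relative_entropy M p0 t =
        (\<Sum>i\<in>?I t. W t i * ln (W t i / (p0 $ i t * (\<Prod>k<t. M $ i (Suc k) $ i k))))"
      by (simp add: path_relative_entropy_def W_def)
    also have "\<dots> = (\<Sum>i\<in>?I t. W t i * ((\<Sum>k<t. \<phi> (i k) (i (Suc k))) + h (i t)) +
        W t i * (ln (p0 $ i 0) - ln (p0 $ i t) - h (i t)))"
      unfolding summand by (intro sum.cong refl) (simp add: algebra_simps)
    finally show ?thesis
      by (simp add: sum.distrib main r_def K_def)
  qed
  have "(\<lambda>t. r t / real t) \<longlonglongrightarrow> 0"
  proof (rule Lim_null_comparison)
    show "\<forall>\<^sub>F t in sequentially. norm (r t / real t) \<le> C / real t"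
      by (intro always_eventually allI) (simp add: divide_right_mono r)
  qed (rule lim_const_over_n)
  then have "(\<lambda>t. \<kappa> + K / real t + r t / real t) \<longlonglongrightarrow> \<kappa> + 0 + 0"
    by (intro tendsto_intros lim_const_over_n)
  moreover have "\<forall>\<^sub>F t in sequentially. \<kappa> + K / real t + r t / real t = path_relative_entropy M p0 t / real t"
    using eventually_gt_at_top[of 0] by eventually_elim (simp add: H field_simps)
  ultimately have "(\<lambda>t. path_relative_entropy M p0 t / real t) \<longlonglongrightarrow> \<kappa>"
    using tendsto_cong by force
  then show ?thesis
    unfolding entropy_production_rate_def by (rule limI)
qed

section \<open>Cycle decomposition of the entropy production\<close>

lemma reverse_all_cycles: "c \<in> all_cycles \<Longrightarrow> reverse_cycle c \<in> all_cycles"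
  by (auto simp: all_cycles_def reverse_cycle_class simple_lists_def)

lemma finite_cycle: "c \<in> all_cycles \<Longrightarrow> finite (c :: 's::finite list set)"
  by (auto simp: all_cycles_def finite_cycle_class)

context stochastic_kernel begin

text \<open>Reversal keeps the set of states, so the forest factor is unchanged and only the edges
  are turned around.\<close>

lemma cycle_mass_reverse:
  assumes "c \<in> all_cycles"
  shows "cycle_mass (reverse_cycle c) = (\<Prod>xs\<in>c. m (hd xs) (last xs)) * forest (\<Union> (set ` c))"
proof -
  have "\<Union> (set ` reverse_cycle c) = \<Union> (set ` c)"
    by (simp add: reverse_cycle_def image_image)
  moreover have "cycle_prod (reverse_cycle c) = (\<Prod>xs\<in>c. m (last (rev xs)) (hd (rev xs)))"
    unfolding cycle_prod_def reverse_cycle_def by (subst prod.reindex) (auto simp: inj_on_def)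
  moreover have "m (last (rev xs)) (hd (rev xs)) = m (hd xs) (last xs)" if "xs \<in> c" for xs
  proof -
    have "xs \<in> simple_lists"
      using that assms by (auto simp: all_cycles_def mem_cycle_class)
    then have "xs \<noteq> []"
      by (simp add: simple_lists_def)
    then show ?thesis
      by (simp add: last_rev hd_rev)
  qed
  ultimately show ?thesis
    by (simp add: cycle_mass_def)
qed

text \<open>The forest factors of \<open>c\<close> and its reverse cancel, leaving a product over
  edges. If the mass of \<open>c\<close> is 0, both sides vanish, whatever the logarithms
  are.\<close>

lemma sum_cycle_log_ratio:
  assumes c: "c \<in> all_cycles" and sym: "\<And>i j. 0 < m i j \<longleftrightarrow> 0 < m j i"
  shows "(\<Sum>xs\<in>c. cycle_mass c * ln (m (last xs) (hd xs) / m (hd xs) (last xs))) =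
    cycle_mass c * ln (cycle_mass c / cycle_mass (reverse_cycle c))"
proof (cases "cycle_mass c = 0")
  case False
  then have "cycle_prod c \<noteq> 0" and f: "forest (\<Union> (set ` c)) \<noteq> 0"
    by (auto simp: cycle_mass_def)
  then have "m (last xs) (hd xs) \<noteq> 0" if "xs \<in> c" for xs
    using that finite_cycle[OF c] by (auto simp: cycle_prod_def)
  then have pos: "0 < m (last xs) (hd xs)" "0 < m (hd xs) (last xs)" if "xs \<in> c" for xs
    using that sym nonneg by (metis less_eq_real_def)+
  have "cycle_mass c / cycle_mass (reverse_cycle c) =
      (\<Prod>xs\<in>c. m (last xs) (hd xs) / m (hd xs) (last xs))"
    using f by (simp add: cycle_mass_reverse[OF c]) (simp add: cycle_mass_def cycle_prod_def prod_dividef)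
  also have "ln \<dots> = (\<Sum>xs\<in>c. ln (m (last xs) (hd xs) / m (hd xs) (last xs)))"
  proof (rule ln_prod)
    fix xs assume "xs \<in> c"
    from pos[OF this] show "m (last xs) (hd xs) / m (hd xs) (last xs) \<noteq> 0"
      by simp
  qed (rule finite_cycle[OF c])
  finally show ?thesis
    by (simp add: sum_distrib_left)
qed simp

text \<open>The circulation identity is applied to the log ratios of the edges, and cycles with a
  marked edge are then grouped by cycle.\<close>

lemma cycle_entropy_decomposition:
  assumes sym: "\<And>i j. 0 < m i j \<longleftrightarrow> 0 < m j i"
  shows "(\<Sum>i\<in>UNIV. \<Sum>j\<in>UNIV. forest {i} * m i j * ln (m i j / m j i)) =
    (\<Sum>c\<in>all_cycles. cycle_mass c * ln (cycle_mass c / cycle_mass (reverse_cycle c)))"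
proof -
  let ?\<phi> = "\<lambda>xs. ln (m (last xs) (hd xs) / m (hd xs) (last xs))"
  have "(\<Sum>i\<in>UNIV. \<Sum>j\<in>UNIV. forest {i} * m i j * ln (m i j / m j i)) =
      (\<Sum>xs\<in>simple_lists. cycle_mass (cycle_class xs) * ?\<phi> xs)"
    by (rule sum_forest_edges)
  also have "\<dots> = (\<Sum>c\<in>all_cycles. \<Sum>xs\<in>c. cycle_mass (cycle_class xs) * ?\<phi> xs)"
    by (rule sum_simple_lists_by_cycle)
  also have "\<dots> = (\<Sum>c\<in>all_cycles. \<Sum>xs\<in>c. cycle_mass c * ?\<phi> xs)"
    by (intro sum.cong refl) (auto simp: all_cycles_def dest: cycle_class_eq)
  also have "\<dots> = (\<Sum>c\<in>all_cycles. cycle_mass c * ln (cycle_mass c / cycle_mass (reverse_cycle c)))"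
    by (intro sum.cong refl sum_cycle_log_ratio sym)
  finally show ?thesis .
qed

end

section \<open>Attractor probabilities and conclusion\<close>

lemma stochastic_kernel_of_matrix:
  "stochastic_matrix M \<Longrightarrow> stochastic_kernel (\<lambda>i j. M $ i $ j)"
  by unfold_locales (auto simp: stochastic_matrix_def probability_vector_def)

lemma attractor_prob_eq:
  fixes M :: "real ^ 's ^ 's::finite"
  assumes "stochastic_matrix M" "c \<in> all_cycles"
  shows "attractor_prob M c = stochastic_kernel.cycle_mass (\<lambda>i j. M $ i $ j) c /
    (\<Sum>c\<in>all_cycles. stochastic_kernel.cycle_mass (\<lambda>i j. M $ i $ j) c)"
proof -
  interpret stochastic_kernel "\<lambda>i j. M $ i $ j"
    using assms(1) by (rule stochastic_kernel_of_matrix)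
  have prob: "measure_pmf.prob (max_entropy_rds M) E = map_prob E" for E
    by (simp add: measure_measure_pmf_finite map_prob_def map_weight_def pmf_max_entropy_rds[OF assms(1)])
  have "{\<alpha>. attractor \<alpha> = c \<and> single_attractor \<alpha>} = {\<alpha>. attractor \<alpha> = c}"
    using assms(2) self_in_cycle_class by (auto simp: attractor_def all_cycles_def)
  then show ?thesis
    using map_prob_attractor[OF assms(2)] map_prob_single_attractor
    by (simp add: attractor_prob_def cond_prob_def prob)
qed

lemma cycles_subset_all_cycles: "cycles M \<subseteq> all_cycles"
  by (auto simp: cycles_def all_cycles_def simple_lists_def)

text \<open>Lets sums over \<open>cycles M\<close> range over \<open>all_cycles\<close>: a forbidden
  edge makes the product over the cycle vanish.\<close>

lemma cycle_mass_eq_0: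
  fixes M :: "real ^ 's ^ 's::finite"
  assumes "stochastic_matrix M" "c \<in> all_cycles" "c \<notin> cycles M"
  shows "stochastic_kernel.cycle_mass (\<lambda>i j. M $ i $ j) c = 0"
proof -
  interpret stochastic_kernel "\<lambda>i j. M $ i $ j"
    using assms(1) by (rule stochastic_kernel_of_matrix)
  obtain xs where xs: "xs \<in> simple_lists" "c = cycle_class xs"
    using assms(2) by (auto simp: all_cycles_def)
  then have "\<not> (\<forall>k<length xs. 0 < M $ (xs ! k) $ (xs ! (Suc k mod length xs)))"
    using assms(3) by (auto simp: cycles_def simple_lists_def)
  then obtain ys where ys: "ys \<in> c" "\<not> 0 < M $ last ys $ hd ys"
    using all_cycle_edges_iff[OF xs(1), of "\<lambda>i j. 0 < M $ i $ j"] xs(2) by auto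
  then have "M $ last ys $ hd ys = 0"
    using nonneg[of "last ys" "hd ys"] by simp
  then have "cycle_prod c = 0"
    unfolding cycle_prod_def using ys(1) finite_cycle[OF assms(2)] by auto
  then show ?thesis
    by (simp add: cycle_mass_def)
qed

theorem theorem4p5:
  fixes P :: "'w measure" and X :: "nat \<Rightarrow> 'w \<Rightarrow> 's::finite"
    and M :: "real ^ 's ^ 's" and \<pi> p0 :: "real ^ 's"
  assumes "markov_chain P X M"
    and "irreducible_matrix M"
    and "aperiodic_matrix M"
    and "stationary_distribution M \<pi>"
    and "\<And>i j. M $ i $ j > 0 \<longleftrightarrow> M $ j $ i > 0"
    and "probability_vector p0"
    and "\<And>i. p0 $ i > 0"
  shows "let w = cycle_weight P X;
             p = attractor_prob M;
             lam = 1 / (\<Sum>c\<in>cycles M. w c);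
             e\<^sub>p = entropy_production_rate M p0
         in e\<^sub>p = (\<Sum>c\<in>cycles M. w c * ln (w c / w (reverse_cycle c))) \<and>
            e\<^sub>p = 1 / lam * (\<Sum>c\<in>cycles M. p c * ln (p c / p (reverse_cycle c)))"
proof -
  have sto: "stochastic_matrix M"
    using assms(1) by (simp add: markov_chain_def)
  interpret stochastic_kernel "\<lambda>i j. M $ i $ j"
    using sto by (rule stochastic_kernel_of_matrix)
  have irred: "(i, j) \<in> {(i, j). 0 < M $ i $ j}\<^sup>*" for i j
    using assms(2) matrix_pow_pos_imp_path[OF nonneg] unfolding irreducible_matrix_def by blast
  define Z where "Z = forest_total"
  define \<Sigma> where "\<Sigma> = (\<Sum>c\<in>all_cycles. cycle_mass c)"
  define L where "L c = ln (cycle_mass c / cycle_mass (reverse_cycle c))" for c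
  have Z: "0 < Z"
    unfolding Z_def by (rule forest_total_pos[OF irred])
  have w: "cycle_weight P X c = cycle_mass c / Z" if "c \<in> all_cycles" for c
    unfolding Z_def
    by (rule cycle_weight_eq[OF assms(1) irred that]) (rule stochastic_kernel_axioms)
  have p: "attractor_prob M c = cycle_mass c / \<Sigma>" if "c \<in> all_cycles" for c
    unfolding \<Sigma>_def by (rule attractor_prob_eq[OF sto that])
  have restrict: "(\<Sum>c\<in>cycles M. cycle_mass c * f c) = (\<Sum>c\<in>all_cycles. cycle_mass c * f c)" for f
    by (rule sum.mono_neutral_left[OF finite_all_cycles cycles_subset_all_cycles])
      (auto simp: cycle_mass_eq_0[OF sto])
  define \<phi> where "\<phi> i j = ln (M $ i $ j / M $ j $ i)" for i j
  \<comment> \<open>The source term is the mean log ratio of one step; its Poisson constant is the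
    entropy production rate.\<close>
  obtain h \<kappa> where h: "\<And>i. h i + \<kappa> =
      (\<Sum>j\<in>UNIV. M $ i $ j * \<phi> i j) + (\<Sum>j\<in>UNIV. M $ i $ j * h j)"
    using poisson_equation[of "\<lambda>i j. M $ i $ j" _ "\<lambda>i. \<Sum>j\<in>UNIV. M $ i $ j * \<phi> i j", OF nonneg row_sum irred]
    by blast
  have e: "entropy_production_rate M p0 = \<kappa>"
    using h by (intro entropy_production_rate_eq[OF sto assms(6,7,5), of h])
      (simp add: \<phi>_def distrib_left sum.distrib)
  \<comment> \<open>Summed against \<open>forest {i}\<close>, the corrector \<open>h\<close> cancels
    by \<open>forest_stationary\<close>; what remains is \<kappa> times the total tree
    weight.\<close>
  have "(\<Sum>i\<in>UNIV. forest {i} * (h i + \<kappa>)) =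
      (\<Sum>i\<in>UNIV. \<Sum>j\<in>UNIV. forest {i} * M $ i $ j * \<phi> i j) +
      (\<Sum>i\<in>UNIV. \<Sum>j\<in>UNIV. forest {i} * M $ i $ j * h j)"
    by (simp add: h distrib_left sum.distrib sum_distrib_left mult.assoc)
  then have "\<kappa> * Z = (\<Sum>i\<in>UNIV. \<Sum>j\<in>UNIV. forest {i} * M $ i $ j * \<phi> i j)"
    unfolding forest_stationary
    by (simp add: Z_def forest_total_def distrib_left sum.distrib mult.commute[of _ \<kappa>] flip: sum_distrib_left)
  also have "\<dots> = (\<Sum>c\<in>all_cycles. cycle_mass c * L c)"
    unfolding \<phi>_def L_def by (rule cycle_entropy_decomposition) (rule assms(5))
  finally have \<kappa>: "\<kappa> = (\<Sum>c\<in>all_cycles. cycle_mass c * L c) / Z"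
    using Z by (simp add: field_simps)
  have cyc: "c \<in> all_cycles" "reverse_cycle c \<in> all_cycles" if "c \<in> cycles M" for c
    using that cycles_subset_all_cycles reverse_all_cycles by blast+
  have "(\<Sum>c\<in>cycles M. cycle_weight P X c * ln (cycle_weight P X c / cycle_weight P X (reverse_cycle c))) =
      (\<Sum>c\<in>cycles M. cycle_mass c * L c) / Z"
    unfolding sum_divide_distrib using Z by (intro sum.cong refl) (simp add: w cyc L_def)
  then have first: "\<kappa> = (\<Sum>c\<in>cycles M. cycle_weight P X c *
      ln (cycle_weight P X c / cycle_weight P X (reverse_cycle c)))"
    by (simp add: \<kappa> restrict)
  have "(\<Sum>c\<in>cycles M. cycle_weight P X c) = (\<Sum>c\<in>cycles M. cycle_mass c * 1) / Z"
    unfolding sum_divide_distrib by (intro sum.cong refl) (simp add: w cyc)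
  \<comment> \<open>This is \<open>1 / lam\<close>; it exchanges the normalizer \<Sigma> of the
    attractor probabilities for the normalizer \<open>Z\<close> of the weights.\<close>
  then have W: "(\<Sum>c\<in>cycles M. cycle_weight P X c) = \<Sigma> / Z"
    unfolding restrict by (simp add: \<Sigma>_def)
  have second: "\<kappa> = \<Sigma> / Z * (\<Sum>c\<in>cycles M. attractor_prob M c *
      ln (attractor_prob M c / attractor_prob M (reverse_cycle c)))"
  proof (cases "\<Sigma> = 0")
    \<comment> \<open>If \<Sigma> = 0, all cycle masses are 0, so \<kappa> is 0 as well and both
      sides vanish.\<close>
    case True
    then have "cycle_mass c = 0" if "c \<in> all_cycles" for c
      using that unfolding \<Sigma>_def
      by (subst (asm) sum_nonneg_eq_0_iff) (auto simp: finite_all_cycles cycle_mass_nonneg)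
    then show ?thesis
      using True by (simp add: \<kappa>)
  next
    case False
    then have "(\<Sum>c\<in>cycles M. attractor_prob M c *
        ln (attractor_prob M c / attractor_prob M (reverse_cycle c))) =
      (\<Sum>c\<in>cycles M. cycle_mass c * L c) / \<Sigma>"
      unfolding sum_divide_distrib by (intro sum.cong refl) (simp add: p cyc L_def)
    then show ?thesis
      using False by (simp add: \<kappa> restrict)
  qed
  show ?thesis
    unfolding Let_def e W using first second by simp
qed

end
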